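(* Let $R$ be the cosemigroup in the variety $\mathbf{Sgp}$ of semigroups whose underlying semigroup is $$|R|=\langle x_{00},x_{11},p_i,q_i\ (i\in\omega)\mid x_{00}^2=x_{00},\ x_{11}^2=x_{11},\ x_{00}p_i=p_i=p_ix_{11},\ x_{11}q_i=q_i=q_ix_{00}\rangle$$ and whose co-operation $\beta^R:|R|\to|R|\amalg|R|$ is the homomorphism determined by $$\beta^R(x_{00})=x_{00}^{(0)},\quad\beta^R(x_{11})=x_{11}^{(1)},\quad \beta^R(p_i)=p_i^{(0)}\big(x_{00}^{(1)}x_{11}^{(0)}\big)^i p_i^{(1)},\quad \beta^R(q_i)=q_i^{(1)}\big(x_{11}^{(0)}x_{00}^{(1)}\big)^i q_i^{(0)},$$ where $u^{(0)},u^{(1)}$ denote the images of $u\in|R|$ under the first and second coprojections $|R|\to|R|\amalg|R|$ (coproduct in semigroups) and a zeroth power means the factor is omitted. Then $R$ is a cosemigroup (i.e. $\beta^R$ is coassociative) and is the final object of $\mathrm{Coalg}(\mathbf{Sgp},\mathbf{Sgp})$. Equivalently, the initial representable functor $E:\mathbf{Sgp}\to\mathbf{Sgp}$ sends a semigroup $A$ to the set of tuples $(a;b;c_0,c_1,\dots;d_0,d_1,\dots)\in|A|^{1+1+\omega+\omega}$ with $a^2=a$, $b^2=b$, $ac_i=c_i=c_ib$, $bd_i=d_i=d_ia$ for all $i$, under the multiplication $(a;b;\dots,c_i,\dots;\dots,d_i,\dots)(a';b';\dots,c'_i,\dots;\dots,d'_i,\dots)=(a;b';\dots,c_i(a'b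)^ic'_i,\dots;\dots,d'_i(ba')^id_i,\dots)$.
   Context: $\mathbf{Sgp}$ is the variety of semigroups (associative binary operation, no identity element). A cosemigroup in $\mathbf{Sgp}$ is a semigroup $|S|$ with a homomorphism $\beta^S:|S|\to|S|\amalg|S|$ into the coproduct (free product) of two copies of itself such that for every semigroup $A$ the set $\mathrm{Hom}(|S|,A)$, with the multiplication $(g\cdot h)=(g\vee h)\circ\beta^S$ (where $g\vee h:|S|\amalg|S|\to A$ restricts to $g$ and $h$ on the two copies), is a semigroup. $\mathrm{Coalg}(\mathbf{Sgp},\mathbf{Sgp})$ is the category of cosemigroups in $\mathbf{Sgp}$ with morphisms the homomorphisms $f$ satisfying $(f\amalg f)\circ\beta^S=\beta^{S'}\circ f$; it is equivalent to the opposite of the category of representable functors $\mathbf{Sgp}\to\mathbf{Sgp}$, $S\mapsto\mathrm{Hom}(|S|,-)$. *)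

theory Defs
  imports "HOL-Algebra.Group"
begin

section \<open>Semigroups (no identity), represented as HOL-Algebra monoid records whose unit is ignored\<close>

definition is_semigroup :: "('a, 'b) monoid_scheme \<Rightarrow> bool" where
  "is_semigroup S \<longleftrightarrow>
     (\<forall>x\<in>carrier S. \<forall>y\<in>carrier S. x \<otimes>\<^bsub>S\<^esub> y \<in> carrier S) \<and>
     (\<forall>x\<in>carrier S. \<forall>y\<in>carrier S. \<forall>z\<in>carrier S.
        (x \<otimes>\<^bsub>S\<^esub> y) \<otimes>\<^bsub>S\<^esub> z = x \<otimes>\<^bsub>S\<^esub> (y \<otimes>\<^bsub>S\<^esub> z))"

fun lprod :: "('a, 'b) monoid_scheme \<Rightarrow> 'a list \<Rightarrow> 'a" where
  "lprod A [] = undefined"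
| "lprod A [x] = x"
| "lprod A (x # y # xs) = x \<otimes>\<^bsub>A\<^esub> lprod A (y # xs)"

fun rmul :: "('a, 'b) monoid_scheme \<Rightarrow> 'a \<Rightarrow> 'a \<Rightarrow> nat \<Rightarrow> 'a" where
  "rmul A x y 0 = x"
| "rmul A x y (Suc n) = rmul A (x \<otimes>\<^bsub>A\<^esub> y) y n"

definition fp_carrier :: "nat set \<Rightarrow> (nat \<Rightarrow> 'a monoid) \<Rightarrow> (nat \<times> 'a) list set" where
  "fp_carrier I S = {w. w \<noteq> [] \<and>
      (\<forall>l\<in>set w. fst l \<in> I \<and> snd l \<in> carrier (S (fst l))) \<and>
      (\<forall>k. Suc k < length w \<longrightarrow> fst (w ! k) \<noteq> fst (w ! Suc k))}"

text \<open>Multiplication: concatenate, merging the two boundary letters if they come from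
  the same factor (no identity, so no further reduction).\<close>
definition fp_mult :: "(nat \<Rightarrow> 'a monoid) \<Rightarrow> (nat \<times> 'a) list \<Rightarrow> (nat \<times> 'a) list \<Rightarrow> (nat \<times> 'a) list" where
  "fp_mult S u v =
     (if u \<noteq> [] \<and> v \<noteq> [] \<and> fst (last u) = fst (hd v)
      then butlast u @ [(fst (hd v), snd (last u) \<otimes>\<^bsub>S (fst (hd v))\<^esub> snd (hd v))] @ tl v
      else u @ v)"

definition free_prod :: "nat set \<Rightarrow> (nat \<Rightarrow> 'a monoid) \<Rightarrow> (nat \<times> 'a) list monoid" where
  "free_prod I S = \<lparr>carrier = fp_carrier I S, mult = fp_mult S, one = undefined\<rparr>"

definition fp_in :: "nat \<Rightarrow> 'a \<Rightarrow> (nat \<times> 'a) list" where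
  "fp_in i x = [(i, x)]"

definition fp_lift :: "('c, 'd) monoid_scheme \<Rightarrow> (nat \<Rightarrow> 'a \<Rightarrow> 'c) \<Rightarrow> (nat \<times> 'a) list \<Rightarrow> 'c" where
  "fp_lift A f w = lprod A (map (\<lambda>l. f (fst l) (snd l)) w)"

abbreviation cop2 :: "'a monoid \<Rightarrow> (nat \<times> 'a) list monoid" where
  "cop2 S \<equiv> free_prod {0, 1} (\<lambda>_. S)"

abbreviation cop3 :: "'a monoid \<Rightarrow> (nat \<times> 'a) list monoid" where
  "cop3 S \<equiv> free_prod {0, 1, 2} (\<lambda>_. S)"

definition is_cosemigroup :: "'a monoid \<Rightarrow> ('a \<Rightarrow> (nat \<times> 'a) list) \<Rightarrow> bool" where
  "is_cosemigroup S \<beta> \<longleftrightarrow>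
     is_semigroup S \<and> \<beta> \<in> hom S (cop2 S) \<and>
     (\<forall>x\<in>carrier S.
        fp_lift (cop3 S)
          (\<lambda>i y. if i = 0 then fp_lift (cop3 S) (\<lambda>j z. fp_in j z) (\<beta> y) else fp_in 2 y) (\<beta> x)
      = fp_lift (cop3 S)
          (\<lambda>i y. if i = 0 then fp_in 0 y else fp_lift (cop3 S) (\<lambda>j z. fp_in (j + 1) z) (\<beta> y)) (\<beta> x))"

definition cosg_mor ::
  "'a monoid \<Rightarrow> ('a \<Rightarrow> (nat \<times> 'a) list) \<Rightarrow> 'b monoid \<Rightarrow> ('b \<Rightarrow> (nat \<times> 'b) list) \<Rightarrow> ('a \<Rightarrow> 'b) \<Rightarrow> bool" where
  "cosg_mor S \<beta> S' \<beta>' f \<longleftrightarrow>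
     f \<in> hom S S' \<and>
     (\<forall>x\<in>carrier S. fp_lift (cop2 S') (\<lambda>i y. fp_in i (f y)) (\<beta> x) = \<beta>' (f x))"

inductive pcong :: "('g list \<times> 'g list) set \<Rightarrow> 'g list \<Rightarrow> 'g list \<Rightarrow> bool" for Rel where
  base: "(u, v) \<in> Rel \<Longrightarrow> pcong Rel u v"
| refl: "pcong Rel u u"
| sym: "pcong Rel u v \<Longrightarrow> pcong Rel v u"
| trans: "pcong Rel u v \<Longrightarrow> pcong Rel v w \<Longrightarrow> pcong Rel u w"
| ctxt: "pcong Rel u v \<Longrightarrow> pcong Rel (a @ u @ b) (a @ v @ b)"

definition pcls :: "('g list \<times> 'g list) set \<Rightarrow> 'g list \<Rightarrow> 'g list set" where
  "pcls Rel w = {v. v \<noteq> [] \<and> pcong Rel w v}"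

definition presented :: "('g list \<times> 'g list) set \<Rightarrow> 'g list set monoid" where
  "presented Rel =
     \<lparr>carrier = {pcls Rel w | w. w \<noteq> []},
      mult = (\<lambda>A B. {v. v \<noteq> [] \<and> (\<exists>a\<in>A. \<exists>b\<in>B. pcong Rel (a @ b) v)}),
      one = undefined\<rparr>"

datatype rgen = X00 | X11 | P nat | Q nat

definition R_rels :: "(rgen list \<times> rgen list) set" where
  "R_rels = {([X00, X00], [X00]), ([X11, X11], [X11])} \<union>
     (\<Union>i. {([X00, P i], [P i]), ([P i, X11], [P i]), ([X11, Q i], [Q i]), ([Q i, X00], [Q i])})"

definition Rsg :: "rgen list set monoid" where
  "Rsg = presented R_rels"

definition gk :: "nat \<Rightarrow> rgen \<Rightarrow> (nat \<times> rgen list set) list" where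
  "gk k u = fp_in k (pcls R_rels [u])"

fun betaR_gen :: "rgen \<Rightarrow> (nat \<times> rgen list set) list" where
  "betaR_gen X00 = gk 0 X00"
| "betaR_gen X11 = gk 1 X11"
| "betaR_gen (P i) =
     rmul (cop2 Rsg) (gk 0 (P i)) (gk 1 X00 \<otimes>\<^bsub>cop2 Rsg\<^esub> gk 0 X11) i
       \<otimes>\<^bsub>cop2 Rsg\<^esub> gk 1 (P i)"
| "betaR_gen (Q i) =
     rmul (cop2 Rsg) (gk 1 (Q i)) (gk 0 X11 \<otimes>\<^bsub>cop2 Rsg\<^esub> gk 1 X00) i
       \<otimes>\<^bsub>cop2 Rsg\<^esub> gk 0 (Q i)"

text \<open>The homomorphism determined by the generator images (evaluated on a representative;
  that this is well defined and a homomorphism is part of the claim is_cosemigroup).\<close>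
definition betaR :: "rgen list set \<Rightarrow> (nat \<times> rgen list set) list" where
  "betaR C = lprod (cop2 Rsg) (map betaR_gen (SOME w. w \<in> C))"

end

theory Submission
  imports Defs
begin

text \<open>
  Applying the co-operation of a cosemigroup twice (three times) to an element and forgetting
  everything except the copy a letter comes from yields a word without equal neighbours over the
  labels \<open>0,1,2\<close> (\<open>0,1,2,3\<close>). By coassociativity, merging any two adjacent labels in the second
  word gives the first one. This alone forces the words to be products of the label words of the
  generators of R: cutting off the first crossing from \<open>0\<close> to the top label leaves a shorter word with
  the same merging property, and the cut-off piece is either a jump or the word of some \<open>p\<^sub>i\<close>, where \<open>i\<close>
  counts the oscillations before the first visit of label \<open>2\<close>; crossings downwards give the \<open>q\<^sub>i\<close>.
  On R the ternary label word is injective, by the normal forms. Sending \<open>x\<close> to the element of R with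
  the same ternary label word is therefore the only candidate for a morphism; it is a homomorphism,
  and it is compatible with the co-operations because the quaternary label word of \<open>x\<close>, which is
  determined by the ternary one, records the ternary label words of all letters of the image of \<open>x\<close>
  under the co-operation.
\<close>

section \<open>Products of lists and iterated right multiplication in semigroups\<close>

lemma semigroup_closed:
  "is_semigroup A \<Longrightarrow> x \<in> carrier A \<Longrightarrow> y \<in> carrier A \<Longrightarrow> x \<otimes>\<^bsub>A\<^esub> y \<in> carrier A"
  by (simp add: is_semigroup_def)

lemma semigroup_assoc:
  "is_semigroup A \<Longrightarrow> x \<in> carrier A \<Longrightarrow> y \<in> carrier A \<Longrightarrow> z \<in> carrier A \<Longrightarrow>
     (x \<otimes>\<^bsub>A\<^esub> y) \<otimes>\<^bsub>A\<^esub> z = x \<otimes>\<^bsub>A\<^esub> (y \<otimes>\<^bsub>A\<^esub> z)"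
  by (simp add: is_semigroup_def)

lemma lprod_closed:
  "is_semigroup A \<Longrightarrow> xs \<noteq> [] \<Longrightarrow> set xs \<subseteq> carrier A \<Longrightarrow> lprod A xs \<in> carrier A"
  by (induction A xs rule: lprod.induct) (auto simp: semigroup_closed)

lemma lprod_Cons: "xs \<noteq> [] \<Longrightarrow> lprod A (x # xs) = x \<otimes>\<^bsub>A\<^esub> lprod A xs"
  by (cases xs) auto

lemma lprod_append:
  assumes "is_semigroup A" "xs \<noteq> []" "ys \<noteq> []" "set xs \<subseteq> carrier A" "set ys \<subseteq> carrier A"
  shows "lprod A (xs @ ys) = lprod A xs \<otimes>\<^bsub>A\<^esub> lprod A ys"
  using assms
proof (induction xs)
  case (Cons x xs)
  then show ?case
    by (cases "xs = []") (auto simp: lprod_Cons semigroup_assoc lprod_closed)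
qed simp

lemma lprod_merge:
  assumes "is_semigroup A" "set xs \<subseteq> carrier A" "a \<in> carrier A" "b \<in> carrier A" "set ys \<subseteq> carrier A"
  shows "lprod A (xs @ (a \<otimes>\<^bsub>A\<^esub> b) # ys) = lprod A (xs @ a # b # ys)"
  using assms
proof (induction xs)
  case Nil
  then show ?case
    by (cases "ys = []") (auto simp: lprod_Cons semigroup_assoc lprod_closed)
qed (auto simp: lprod_Cons)

lemma hom_lprod:
  assumes "is_semigroup A" "h \<in> hom A B" "xs \<noteq> []" "set xs \<subseteq> carrier A"
  shows "h (lprod A xs) = lprod B (map h xs)"
  using assms
proof (induction xs)
  case (Cons x xs)
  then show ?case
    by (cases "xs = []") (auto simp: lprod_Cons lprod_closed hom_mult)
qed simp

lemma rmul_closed: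
  "is_semigroup A \<Longrightarrow> x \<in> carrier A \<Longrightarrow> y \<in> carrier A \<Longrightarrow> rmul A x y n \<in> carrier A"
  by (induction n arbitrary: x) (auto simp: semigroup_closed)

lemma hom_rmul:
  "is_semigroup A \<Longrightarrow> h \<in> hom A B \<Longrightarrow> x \<in> carrier A \<Longrightarrow> y \<in> carrier A \<Longrightarrow>
     h (rmul A x y n) = rmul B (h x) (h y) n"
  by (induction n arbitrary: x) (auto simp: semigroup_closed hom_mult)

text \<open>Since \<open>rmul\<close> accumulates in its second argument, a left factor passes into
  the starting value; this replaces every computation with powers, which a semigroup without unit
  lacks for exponent 0.\<close>

lemma mult_rmul:
  "is_semigroup A \<Longrightarrow> z \<in> carrier A \<Longrightarrow> x \<in> carrier A \<Longrightarrow> y \<in> carrier A \<Longrightarrow>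
     z \<otimes>\<^bsub>A\<^esub> rmul A x y n = rmul A (z \<otimes>\<^bsub>A\<^esub> x) y n"
  by (induction n arbitrary: x) (auto simp: semigroup_closed semigroup_assoc)

section \<open>Free products\<close>

lemma fp_carrier_iff:
  "w \<in> fp_carrier I S \<longleftrightarrow> w \<noteq> [] \<and> (\<forall>(i, a)\<in>set w. i \<in> I \<and> a \<in> carrier (S i)) \<and> distinct_adj (map fst w)"
  unfolding fp_carrier_def distinct_adj_conv_nth
  by (auto simp: Suc_lessD case_prod_beta)

lemma carrier_free_prod [simp]: "carrier (free_prod I S) = fp_carrier I S"
  and mult_free_prod [simp]: "u \<otimes>\<^bsub>free_prod I S\<^esub> v = fp_mult S u v"
  by (simp_all add: free_prod_def)

lemma fp_mult_snoc_Cons: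
  "fp_mult S (u @ [(i, a)]) ((j, b) # v) =
     (if i = j then u @ (i, a \<otimes>\<^bsub>S i\<^esub> b) # v else u @ (i, a) # (j, b) # v)"
  by (auto simp: fp_mult_def)

lemma fp_carrier_snocE:
  assumes "u \<in> fp_carrier I S"
  obtains u' i a where "u = u' @ [(i, a)]" "i \<in> I" "a \<in> carrier (S i)"
  using assms unfolding fp_carrier_iff by (cases u rule: rev_cases) auto

lemma fp_carrier_ConsE:
  assumes "u \<in> fp_carrier I S"
  obtains u' i a where "u = (i, a) # u'" "i \<in> I" "a \<in> carrier (S i)"
  using assms unfolding fp_carrier_iff by (cases u) auto

lemma fp_mult_closed:
  assumes "\<And>i. i \<in> I \<Longrightarrow> is_semigroup (S i)" "u \<in> fp_carrier I S" "v \<in> fp_carrier I S"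
  shows "fp_mult S u v \<in> fp_carrier I S"
proof -
  obtain u' i a where u: "u = u' @ [(i, a)]" using assms(2) by (rule fp_carrier_snocE)
  obtain v' j b where v: "v = (j, b) # v'" using assms(3) by (rule fp_carrier_ConsE)
  show ?thesis
    using assms unfolding u v fp_mult_snoc_Cons fp_carrier_iff
    by (auto simp: distinct_adj_append_iff distinct_adj_Cons semigroup_closed)
qed

text \<open>Merging only touches boundary letters. If the middle word has two or more letters, the
  two merges are independent; a one-letter middle word may merge on both sides, and there
  associativity of the factor is used.\<close>

lemma fp_mult_assoc:
  assumes sg: "\<And>i. i \<in> I \<Longrightarrow> is_semigroup (S i)"
    and u: "u \<in> fp_carrier I S" and v: "v \<in> fp_carrier I S" and w: "w \<in> fp_carrier I S"
  shows "fp_mult S (fp_mult S u v) w = fp_mult S u (fp_mult S v w)"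
proof -
  obtain u' i a where u': "u = u' @ [(i, a)]" "i \<in> I" "a \<in> carrier (S i)"
    using u by (rule fp_carrier_snocE)
  obtain w' k c where w': "w = (k, c) # w'" "k \<in> I" "c \<in> carrier (S k)"
    using w by (rule fp_carrier_ConsE)
  obtain v' j b where v': "v = (j, b) # v'" "j \<in> I" "b \<in> carrier (S j)"
    using v by (rule fp_carrier_ConsE)
  show ?thesis
  proof (cases v' rule: rev_cases)
    case Nil
    have 1: "fp_mult S u v = (if i = j then u' @ [(i, a \<otimes>\<^bsub>S i\<^esub> b)] else (u' @ [(i, a)]) @ [(j, b)])"
      by (simp add: u' v' Nil fp_mult_snoc_Cons)
    have 2: "fp_mult S v w = (if j = k then (j, b \<otimes>\<^bsub>S j\<^esub> c) # w' else (j, b) # (k, c) # w')"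
      using fp_mult_snoc_Cons[of S "[]" j b k c w'] by (simp add: v' w' Nil)
    show ?thesis
      using u' v' w' sg unfolding 1 2
      by (auto simp: fp_mult_snoc_Cons semigroup_assoc simp del: append_assoc)
  next
    case (snoc v'' l)
    obtain m d where l: "l = (m, d)" by (cases l)
    have 1: "fp_mult S u v = (if i = j then u' @ (i, a \<otimes>\<^bsub>S i\<^esub> b) # v'' else u' @ (i, a) # (j, b) # v'') @ [(m, d)]"
      by (simp add: u' v' snoc l fp_mult_snoc_Cons)
    have "fp_mult S v w =
      (if m = k then ((j, b) # v'') @ (m, d \<otimes>\<^bsub>S m\<^esub> c) # w' else ((j, b) # v'') @ (m, d) # (k, c) # w')"
      using fp_mult_snoc_Cons[of S "(j, b) # v''" m d k c w'] by (simp add: v' w' snoc l)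
    then have 2: "fp_mult S v w =
      (j, b) # (if m = k then v'' @ (m, d \<otimes>\<^bsub>S m\<^esub> c) # w' else v'' @ (m, d) # (k, c) # w')"
      by simp
    show ?thesis
      unfolding 1 2 unfolding u' w' fp_mult_snoc_Cons by simp
  qed
qed

lemma free_prod_semigroup:
  assumes "\<And>i. i \<in> I \<Longrightarrow> is_semigroup (S i)"
  shows "is_semigroup (free_prod I S)"
  unfolding is_semigroup_def using fp_mult_closed[OF assms] fp_mult_assoc[OF assms] by simp

lemma fp_in_hom: "i \<in> I \<Longrightarrow> is_semigroup (S i) \<Longrightarrow> fp_in i \<in> hom (S i) (free_prod I S)"
  by (auto simp: hom_def fp_in_def fp_carrier_iff fp_mult_def)

lemma fp_lift_in [simp]: "fp_lift A f (fp_in i x) = f i x"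
  by (simp add: fp_lift_def fp_in_def)

text \<open>Existence half of the universal property of the coproduct. Merging two boundary letters
  does not change the value because each \<open>f i\<close> is multiplicative, so
  \<open>fp_mult\<close> may be replaced by concatenation.\<close>

lemma fp_lift_hom:
  assumes sg: "is_semigroup A" and f: "\<And>i. i \<in> I \<Longrightarrow> f i \<in> hom (S i) A"
  shows "fp_lift A f \<in> hom (free_prod I S) A"
proof (rule homI)
  have sub: "(\<lambda>l. f (fst l) (snd l)) ` set w \<subseteq> carrier A" if "w \<in> fp_carrier I S" for w
    using that hom_in_carrier[OF f] unfolding fp_carrier_iff by fastforce
  show "fp_lift A f w \<in> carrier A" if "w \<in> carrier (free_prod I S)" for w
    using that sub[of w] lprod_closed[OF sg, of "map (\<lambda>l. f (fst l) (snd l)) w"]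
    by (simp add: fp_lift_def fp_carrier_iff)
  fix u v assume "u \<in> carrier (free_prod I S)" "v \<in> carrier (free_prod I S)"
  then have u: "u \<in> fp_carrier I S" and v: "v \<in> fp_carrier I S" by auto
  obtain u' i a where u': "u = u' @ [(i, a)]" "i \<in> I" "a \<in> carrier (S i)"
    using u by (rule fp_carrier_snocE)
  obtain v' j b where v': "v = (j, b) # v'" "j \<in> I" "b \<in> carrier (S j)"
    using v by (rule fp_carrier_ConsE)
  have "fp_lift A f (fp_mult S u v) = fp_lift A f (u @ v)"
  proof (cases "i = j")
    case True
    have "f j (a \<otimes>\<^bsub>S j\<^esub> b) = f j a \<otimes>\<^bsub>A\<^esub> f j b"
      using f u' v' True by (auto simp: hom_mult)
    moreover have "f j a \<in> carrier A" "f j b \<in> carrier A"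
      using u' v' True hom_in_carrier[OF f[of j], of a] hom_in_carrier[OF f[of j], of b] by auto
    ultimately show ?thesis
      using sub[OF u] sub[OF v] True
      unfolding u'(1) v'(1) fp_mult_snoc_Cons fp_lift_def by (simp add: lprod_merge[OF sg])
  qed (simp add: u' v' fp_mult_snoc_Cons)
  also have "\<dots> = fp_lift A f u \<otimes>\<^bsub>A\<^esub> fp_lift A f v"
    using sub[OF u] sub[OF v] u' v' unfolding fp_lift_def
    by (simp only: map_append) (subst lprod_append[OF sg], auto)
  finally show "fp_lift A f (u \<otimes>\<^bsub>free_prod I S\<^esub> v) = fp_lift A f u \<otimes>\<^bsub>A\<^esub> fp_lift A f v"
    by simp
qed

lemma hom_fp_lift:
  assumes "is_semigroup A" "h \<in> hom A B" "w \<in> fp_carrier I S"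
    and "\<And>i x. i \<in> I \<Longrightarrow> x \<in> carrier (S i) \<Longrightarrow> f i x \<in> carrier A"
  shows "h (fp_lift A f w) = fp_lift B (\<lambda>i x. h (f i x)) w"
  using assms unfolding fp_lift_def
  by (subst hom_lprod[of A h B]) (auto simp: fp_carrier_iff comp_def)

lemma fp_lift_cong:
  assumes "w \<in> fp_carrier I S" "\<And>i x. i \<in> I \<Longrightarrow> x \<in> carrier (S i) \<Longrightarrow> f i x = g i x"
  shows "fp_lift A f w = fp_lift A g w"
proof -
  have "map (\<lambda>l. f (fst l) (snd l)) w = map (\<lambda>l. g (fst l) (snd l)) w"
    using assms by (auto simp: fp_carrier_iff)
  then show ?thesis unfolding fp_lift_def by (rule arg_cong)
qed

text \<open>Neighbouring letters lie in different copies, so nothing merges. This makes the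
  coproduct of a map with itself, as it occurs in \<open>cosg_mor\<close>, act letter by
  letter.\<close>

lemma fp_lift_fp_in:
  assumes "distinct_adj (map fst w)" "w \<noteq> []"
  shows "fp_lift (free_prod I S) (\<lambda>i x. fp_in i (f x)) w = map (\<lambda>(i, x). (i, f x)) w"
  using assms
proof (induction w)
  case (Cons l w)
  show ?case
  proof (cases w)
    case (Cons l' w')
    then have "fp_lift (free_prod I S) (\<lambda>i x. fp_in i (f x)) (l # w) =
      fp_mult S (fp_in (fst l) (f (snd l))) (map (\<lambda>(i, x). (i, f x)) w)"
      using Cons.IH Cons.prems by (simp add: fp_lift_def)
    then show ?thesis using Cons Cons.prems by (auto simp: fp_mult_def fp_in_def split: prod.splits)
  qed (auto simp: fp_lift_def fp_in_def split: prod.splits)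
qed simp

section \<open>Presented semigroups\<close>

text \<open>The congruence lives on all words, although the empty word represents no element and
  \<open>lprod\<close> has no meaningful value on it; this keeps the empty word in a class of its
  own.\<close>

lemma pcong_Nil_iff:
  assumes "pcong Rel u v" "\<And>u v. (u, v) \<in> Rel \<Longrightarrow> u \<noteq> [] \<and> v \<noteq> []"
  shows "u = [] \<longleftrightarrow> v = []"
  using assms(1)
proof induction
  case (base u v)
  then show ?case using assms(2) by metis
qed auto

lemma pcong_append: "pcong Rel u u' \<Longrightarrow> pcong Rel v v' \<Longrightarrow> pcong Rel (u @ v) (u' @ v')"
  using pcong.ctxt[of Rel u u' "[]" v] pcong.ctxt[of Rel v v' u' "[]"]
  by (auto intro: pcong.trans)

lemma pcls_eq_iff: "v \<noteq> [] \<Longrightarrow> pcls Rel u = pcls Rel v \<longleftrightarrow> pcong Rel u v"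
  unfolding pcls_def set_eq_iff mem_Collect_eq by (metis pcong.refl pcong.sym pcong.trans)

lemma pcls_mem: "u \<noteq> [] \<Longrightarrow> u \<in> pcls Rel u"
  by (simp add: pcls_def pcong.refl)

lemma presented_mult:
  assumes "u \<noteq> []" "v \<noteq> []"
  shows "pcls Rel u \<otimes>\<^bsub>presented Rel\<^esub> pcls Rel v = pcls Rel (u @ v)"
proof -
  have "pcong Rel (u @ v) w" if "pcong Rel u a" "pcong Rel v b" "pcong Rel (a @ b) w" for a b w
    using pcong_append[OF that(1,2)] that(3) by (rule pcong.trans)
  then show ?thesis using assms unfolding presented_def pcls_def by (auto intro: pcong.refl)
qed

lemma presented_carrierE:
  assumes "x \<in> carrier (presented Rel)"
  obtains w where "w \<noteq> []" "x = pcls Rel w"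
  using assms by (auto simp: presented_def)

lemma pcls_carrier: "w \<noteq> [] \<Longrightarrow> pcls Rel w \<in> carrier (presented Rel)"
  by (auto simp: presented_def)

lemma presented_semigroup: "is_semigroup (presented Rel)"
  unfolding is_semigroup_def
  by (auto elim!: presented_carrierE simp: presented_mult pcls_carrier)

lemma pcls_lprod: "w \<noteq> [] \<Longrightarrow> pcls Rel w = lprod (presented Rel) (map (\<lambda>g. pcls Rel [g]) w)"
proof (induction w)
  case (Cons g w)
  then show ?case
    using presented_mult[of "[g]" w Rel] by (cases "w = []") (auto simp: lprod_Cons)
qed simp

lemma presented_hom_eq:
  assumes "h \<in> hom (presented Rel) A" "k \<in> hom (presented Rel) A"
    and "\<And>g. h (pcls Rel [g]) = k (pcls Rel [g])" and "x \<in> carrier (presented Rel)"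
  shows "h x = k x"
proof -
  obtain w where w: "w \<noteq> []" "x = pcls Rel w" using assms(4) by (rule presented_carrierE)
  have x: "x = lprod (presented Rel) (map (\<lambda>g. pcls Rel [g]) w)"
    unfolding w(2) by (rule pcls_lprod[OF w(1)])
  have car: "set (map (\<lambda>g. pcls Rel [g]) w) \<subseteq> carrier (presented Rel)"
    by (auto simp: pcls_carrier)
  have "h x = lprod A (map h (map (\<lambda>g. pcls Rel [g]) w))"
    unfolding x by (rule hom_lprod[OF presented_semigroup assms(1) _ car]) (simp add: w)
  moreover have "k x = lprod A (map k (map (\<lambda>g. pcls Rel [g]) w))"
    unfolding x by (rule hom_lprod[OF presented_semigroup assms(2) _ car]) (simp add: w)
  ultimately show ?thesis by (simp add: comp_def assms(3))
qed

text \<open>Well-definedness of a homomorphism given on generators. In the context case the outer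
  words may be empty, which has to be split off because \<open>lprod_append\<close> speaks of
  nonempty lists.\<close>

lemma pcong_lprod:
  assumes "pcong Rel u v" "u \<noteq> []" and sg: "is_semigroup A" and car: "\<And>x. g x \<in> carrier A"
    and ne_Nil: "\<And>u v. (u, v) \<in> Rel \<Longrightarrow> u \<noteq> [] \<and> v \<noteq> []"
    and rel: "\<And>u v. (u, v) \<in> Rel \<Longrightarrow> lprod A (map g u) = lprod A (map g v)"
  shows "lprod A (map g u) = lprod A (map g v)"
  using assms(1,2)
proof induction
  case (base u v)
  show ?case using base(1) by (rule rel)
next
  case (sym u v)
  have "u = [] \<longleftrightarrow> v = []" using sym(1) ne_Nil by (rule pcong_Nil_iff)
  then show ?case using sym by simp
next
  case (trans u v w)
  have "u = [] \<longleftrightarrow> v = []" using trans(1) ne_Nil by (rule pcong_Nil_iff)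
  then show ?case using trans by simp
next
  case (ctxt u v a b)
  have eq: "u = [] \<longleftrightarrow> v = []" using ctxt(1) ne_Nil by (rule pcong_Nil_iff)
  have ne: "map g w \<noteq> [] \<and> set (map g w) \<subseteq> carrier A" if "w \<noteq> []" for w
    using that car by auto
  have app: "lprod A (map g (u @ v)) = lprod A (map g u) \<otimes>\<^bsub>A\<^esub> lprod A (map g v)"
    if "u \<noteq> []" "v \<noteq> []" for u v
    using ne[OF that(1)] ne[OF that(2)] by (simp add: lprod_append[OF sg])
  show ?case
  proof (cases "u = []")
    case False
    then have v: "v \<noteq> []" using eq by simp
    have "lprod A (map g (u @ b)) = lprod A (map g (v @ b))"
      using ctxt(2) False app[OF False] app[OF v] by (cases "b = []") simp_all
    then show ?thesis
      using False v app[of a "u @ b"] app[of a "v @ b"] by (cases "a = []") simp_all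
  qed (use eq in simp)
qed simp

section \<open>Label words\<close>

text \<open>The coproduct of one-element semigroups indexed by the natural numbers.\<close>

definition labw :: "nat list monoid" where
  "labw = \<lparr>carrier = {w. w \<noteq> [] \<and> distinct_adj w}, mult = (\<lambda>u v. remdups_adj (u @ v)), one = undefined\<rparr>"

definition relabel :: "(nat \<Rightarrow> nat) \<Rightarrow> nat list \<Rightarrow> nat list" where
  "relabel f w = remdups_adj (map f w)"

text \<open>Collapsing keeps the first letter of \<open>v\<close>, and only that letter meets
  \<open>u\<close>. With its mirror image, obtained by reversal, this yields associativity in
  \<open>labw\<close>.\<close>

lemma remdups_adj_append_remdups_adj_right:
  "remdups_adj (u @ remdups_adj v) = remdups_adj (u @ v)"
proof (cases v)
  case (Cons x xs)
  have "remdups_adj (x # xs) = x # tl (remdups_adj (x # xs))" by simp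
  moreover have "remdups_adj (remdups_adj v) = remdups_adj v"
    using distinct_adj_altdef distinct_adj_remdups_adj by blast
  ultimately show ?thesis using Cons by (metis remdups_adj_append)
qed simp

lemma remdups_adj_append_remdups_adj_left:
  "remdups_adj (remdups_adj u @ v) = remdups_adj (u @ v)"
  using remdups_adj_append_remdups_adj_right[of "rev v" "rev u"]
  by (metis remdups_adj_rev rev_append rev_rev_ident)

lemmas remdups_adj_append_remdups_adj =
  remdups_adj_append_remdups_adj_left remdups_adj_append_remdups_adj_right

lemma remdups_adj_map_remdups_adj:
  "remdups_adj (map f (remdups_adj w)) = remdups_adj (map f w)"
proof (induction w rule: remdups_adj.induct)
  case (3 x y xs)
  have "remdups_adj (map f (x # remdups_adj (y # xs))) = remdups_adj (map f (x # y # xs))"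
    using 3 remdups_adj_append_remdups_adj_right[of "[f x]" "map f (y # xs)"]
      remdups_adj_append_remdups_adj_right[of "[f x]" "map f (remdups_adj (y # xs))"]
    by (cases "x = y") auto
  then show ?case using 3 by auto
qed simp_all

lemma remdups_adj_map_inj_on:
  "inj_on f (set w) \<Longrightarrow> remdups_adj (map f w) = map f (remdups_adj w)"
  by (induction w rule: remdups_adj.induct) auto

lemma carrier_labw [simp]: "w \<in> carrier labw \<longleftrightarrow> w \<noteq> [] \<and> distinct_adj w"
  and mult_labw [simp]: "u \<otimes>\<^bsub>labw\<^esub> v = remdups_adj (u @ v)"
  by (simp_all add: labw_def)

lemma labw_semigroup: "is_semigroup labw"
  by (simp add: is_semigroup_def remdups_adj_append_remdups_adj)

lemma lprod_labw:
  "ws \<noteq> [] \<Longrightarrow> set ws \<subseteq> carrier labw \<Longrightarrow> lprod labw ws = remdups_adj (concat ws)"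
proof (induction ws)
  case (Cons w ws)
  then show ?case
    by (cases "ws = []")
      (auto simp: lprod_Cons remdups_adj_append_remdups_adj distinct_adj_altdef)
qed simp

lemma relabel_hom: "relabel f \<in> hom labw labw"
  by (auto simp: hom_def relabel_def remdups_adj_map_remdups_adj remdups_adj_append_remdups_adj)

lemma relabel_relabel: "relabel f (relabel g w) = relabel (\<lambda>k. f (g k)) w"
  by (simp add: relabel_def remdups_adj_map_remdups_adj comp_def)

lemma relabel_cong: "(\<And>k. k \<in> set w \<Longrightarrow> f k = g k) \<Longrightarrow> relabel f w = relabel g w"
  unfolding relabel_def by (metis map_cong)

lemma relabel_const: "w \<noteq> [] \<Longrightarrow> relabel (\<lambda>_. c) w = [c]"
  by (simp add: relabel_def map_replicate_const remdups_adj_replicate)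

lemma relabel_Suc: "distinct_adj w \<Longrightarrow> relabel Suc w = map Suc w"
  by (simp add: relabel_def remdups_adj_map_injective distinct_adj_altdef)

lemma relabel_ident: "distinct_adj w \<Longrightarrow> relabel (\<lambda>k. k) w = w"
  by (simp add: relabel_def distinct_adj_altdef)

text \<open>Merges the labels \<open>k\<close> and \<open>k + 1\<close>.\<close>

definition glue :: "nat \<Rightarrow> nat list \<Rightarrow> nat list" where
  "glue k = relabel (\<lambda>i. if i \<le> k then i else i - 1)"

definition alt :: "nat \<Rightarrow> nat \<Rightarrow> nat \<Rightarrow> nat list" where
  "alt a b i = concat (replicate i [a, b])"

lemma alt_simps [simp]: "alt a b 0 = []" "alt a b (Suc i) = a # b # alt a b i"
  by (simp_all add: alt_def)

lemma map_alt [simp]: "map f (alt a b i) = alt (f a) (f b) i"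
  by (induction i) auto

lemma set_alt: "set (alt a b i) \<subseteq> {a, b}"
  by (induction i) auto

lemma remdups_adj_alt_same [simp]: "remdups_adj (a # alt a a i @ w) = remdups_adj (a # w)"
  by (induction i) auto

lemma remdups_adj_alt [simp]:
  "a \<noteq> b \<Longrightarrow> remdups_adj (a # alt b a i @ b # w) = a # alt b a i @ remdups_adj (b # w)"
  by (induction i) auto

text \<open>Without its final label \<open>n\<close>, the label word over \<open>0..n\<close> of \<open>p\<^sub>i\<close>; reversing the order of the
  labels gives that of \<open>q\<^sub>i\<close>.\<close>

definition climb :: "nat \<Rightarrow> nat \<Rightarrow> nat list" where
  "climb n i = concat (map (\<lambda>k. k # alt (Suc k) k i) [0..<n])"

lemma climb_simps:
  "climb 2 i = 0 # alt 1 0 i @ 1 # alt 2 1 i"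
  "climb 3 i = 0 # alt 1 0 i @ 1 # alt 2 1 i @ 2 # alt 3 2 i"
  by (simp_all add: climb_def upt_rec numeral_2_eq_2 numeral_3_eq_3)

text \<open>The flag \<open>s\<close> tells at which extreme label a crossing starts: at
  \<open>0\<close> for \<open>False\<close>, at \<open>n\<close> for \<open>True\<close>, where the
  order of the labels is reversed.\<close>

definition turn :: "nat \<Rightarrow> bool \<Rightarrow> nat \<Rightarrow> nat" where
  "turn n s k = (if s then n - k else k)"

text \<open>The label word of the normal form \<open>nf s u\<close> introduced below: \<open>None\<close> stands for a direct jump
  between the extreme labels.\<close>

fun enc :: "nat \<Rightarrow> bool \<Rightarrow> nat option list \<Rightarrow> nat list" where
  "enc n s [] = [turn n s 0]"
| "enc n s (None # u) = turn n s 0 # enc n (\<not> s) u"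
| "enc n s (Some i # u) = map (turn n s) (climb n i) @ enc n (\<not> s) u"

section \<open>Effect of merging labels on the words of the generators\<close>

lemma remdups_adj_append_Cons:
  assumes "remdups_adj (xs @ [y]) = zs @ [y]"
  shows "remdups_adj (xs @ y # ys) = zs @ remdups_adj (y # ys)"
  using remdups_adj_append[of xs y ys] assms by simp

text \<open>The oscillation between the two merged labels becomes constant and vanishes, and the
  other two keep their length \<open>i\<close>. The top label belongs to the rest of the word, hence
  the form with \<open>3 # t\<close>.\<close>

lemma glue_climb:
  assumes "k \<le> 2"
  shows "glue k (climb 3 i @ 3 # t) = climb 2 i @ glue k (3 # t)"
proof -
  consider "k = 0" | "k = 1" | "k = 2" using assms by linarith
  \<comment> \<open>The final \<open>2\<close> is the image of the label \<open>3\<close>, the same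
    for all three mergings.\<close>
  then have "remdups_adj (map (\<lambda>i. if i \<le> k then i else i - 1) (climb 3 i) @ [2]) = climb 2 i @ [2]"
    by cases (use remdups_adj_alt_same[of 2 i "[2]"] in \<open>simp_all add: climb_simps\<close>)
  from remdups_adj_append_Cons[OF this] show ?thesis
    using assms by (simp add: glue_def relabel_def)
qed

text \<open>Under reversal of the four labels, merging \<open>k\<close> with \<open>k + 1\<close>
  turns into merging \<open>2 - k\<close> with \<open>3 - k\<close>. This reduces downward crossings
  to upward ones.\<close>

lemma glue_turn:
  assumes "k \<le> 2" "set w \<subseteq> {..3}"
  shows "glue k (map (turn 3 s) w) = map (turn 2 s) (glue (turn 2 s k) w)"
proof -
  have "inj_on (turn 2 s) {..2}" by (auto simp: inj_on_def turn_def)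
  moreover have "set (map (\<lambda>i. if i \<le> turn 2 s k then i else i - 1) w) \<subseteq> {..2}"
    using assms by (auto simp: turn_def)
  ultimately have "inj_on (turn 2 s) (set (map (\<lambda>i. if i \<le> turn 2 s k then i else i - 1) w))"
    by (rule inj_on_subset)
  then have "remdups_adj (map (turn 2 s) (map (\<lambda>i. if i \<le> turn 2 s k then i else i - 1) w)) =
      map (turn 2 s) (remdups_adj (map (\<lambda>i. if i \<le> turn 2 s k then i else i - 1) w))"
    by (rule remdups_adj_map_inj_on)
  moreover have "map (\<lambda>i. if i \<le> k then i else i - 1) (map (turn 3 s) w) =
      map (turn 2 s) (map (\<lambda>i. if i \<le> turn 2 s k then i else i - 1) w)"
    using assms by (fastforce simp: turn_def)
  ultimately show ?thesis unfolding glue_def relabel_def by argo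
qed

section \<open>Classification of the words over four labels whose three mergings agree\<close>

lemma turn_turn: "k \<le> n \<Longrightarrow> turn n s (turn n s k) = k"
  by (simp add: turn_def)

text \<open>A word starting at \<open>0\<close> oscillates between \<open>0\<close> and
  \<open>1\<close> until it ends or first meets \<open>c\<close>, one of the labels \<open>2\<close>
  and \<open>3\<close>; \<open>i\<close> counts the returns to \<open>0\<close>.\<close>

lemma scan_low_labels:
  assumes "distinct_adj (0 # v)" "set v \<subseteq> {..3}"
  shows "\<exists>i. 0 # v = 0 # alt 1 0 i \<or> 0 # v = 0 # alt 1 0 i @ [1] \<or>
    (\<exists>c t. c \<in> {2, 3} \<and> (0 # v = 0 # alt 1 0 i @ c # t \<or> 0 # v = 0 # alt 1 0 i @ 1 # c # t))"
  using assms
proof (induction v rule: length_induct)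
  case (1 v)
  show ?case
  proof (cases v)
    case (Cons a v')
    with 1 have "a = 1 \<or> a \<in> {2, 3}" by auto
    then show ?thesis
    proof
      assume a: "a = 1"
      show ?thesis
      proof (cases v')
        case Nil
        with Cons a show ?thesis by (auto intro: exI[of _ 0])
      next
        case (Cons b v'')
        with 1(2,3) \<open>v = a # v'\<close> a have b: "b = 0 \<or> b \<in> {2, 3}" by auto
        show ?thesis
        proof (cases "b = 0")
          case True
          with 1(2,3) Cons \<open>v = a # v'\<close> have "distinct_adj (0 # v'')" "set v'' \<subseteq> {..3}" by auto
          with 1(1) Cons \<open>v = a # v'\<close> obtain i where
            "0 # v'' = 0 # alt 1 0 i \<or> 0 # v'' = 0 # alt 1 0 i @ [1] \<or>
             (\<exists>c t. c \<in> {2, 3} \<and> (0 # v'' = 0 # alt 1 0 i @ c # t \<or> 0 # v'' = 0 # alt 1 0 i @ 1 # c # t))"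
            by (metis length_Cons less_Suc_eq less_SucI)
          then show ?thesis using Cons \<open>v = a # v'\<close> a True
            by (intro exI[of _ "Suc i"]) auto
        next
          case False
          then show ?thesis using b Cons \<open>v = a # v'\<close> a by (intro exI[of _ 0]) auto
        qed
      qed
    next
      assume "a \<in> {2, 3}"
      then show ?thesis using Cons by (intro exI[of _ 0] disjI2 exI[of _ a] exI[of _ v']) simp
    qed
  qed (auto intro: exI[of _ 0])
qed

lemma glue_Cons_Cons:
  "glue k (x # y # t) =
     (let a = if x \<le> k then x else x - 1; b = if y \<le> k then y else y - 1
      in if a = b then glue k (y # t) else a # glue k (y # t))"
  by (auto simp: glue_def relabel_def Let_def)

lemma glue_Cons_neq:
  assumes "(if x \<le> k then x else x - 1) \<noteq> (if y \<le> k then y else y - 1)"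
  shows "glue k (x # y # t) = (if x \<le> k then x else x - 1) # glue k (y # t)"
  using assms unfolding glue_Cons_Cons Let_def by (rule if_not_P)

lemma glue_singleton: "glue k [x] = [if x \<le> k then x else x - 1]"
  by (simp add: glue_def relabel_def)

lemma glue_Cons_eq_Cons: "glue k (x # t) = y # r \<Longrightarrow> y = (if x \<le> k then x else x - 1)"
  using hd_remdups_adj[of "map (\<lambda>i. if i \<le> k then i else i - 1) (x # t)"]
  unfolding glue_def relabel_def by (simp only:) simp

text \<open>The first merging fixes how often label \<open>2\<close> occurs before \<open>3\<close>; the second one rules out
  that label \<open>0\<close> is visited in between.\<close>

lemma glue_split_middle:
  assumes "distinct_adj (2 # t)" "set t \<subseteq> {..3}"
    and "glue 0 (2 # t) = alt 1 0 i @ 1 # 2 # r" "glue 1 (2 # t) = 1 # 2 # r'"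
  shows "\<exists>t'. 2 # t = alt 2 1 i @ 2 # 3 # t'"
  using assms
proof (induction i arbitrary: t)
  case 0
  obtain a t' where t: "t = a # t'" using 0 by (cases t) (auto simp: glue_singleton)
  have a': "a \<noteq> 2" "a \<le> 3" using 0 t by auto
  have "glue 0 (2 # a # t') = 1 # glue 0 (a # t')"
    using a' glue_Cons_neq[of 2 0 a t'] by (cases "a = 0") auto
  with 0(3) have "glue 0 (a # t') = 2 # r" by (simp add: t)
  from glue_Cons_eq_Cons[OF this] a' have "a = 3" by (simp split: if_splits)
  then show ?case by (simp add: t)
next
  case (Suc i)
  obtain a t' where t: "t = a # t'" using Suc.prems by (cases t) (auto simp: glue_singleton)
  have a': "a \<noteq> 2" "a \<le> 3" using Suc.prems t by auto
  have "glue 0 (2 # a # t') = 1 # glue 0 (a # t')"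
    using a' glue_Cons_neq[of 2 0 a t'] by (cases "a = 0") auto
  with Suc.prems(3) have 0: "glue 0 (a # t') = 0 # alt 1 0 i @ 1 # 2 # r" by (simp add: t)
  have "a \<noteq> 0"
  proof
    assume "a = 0"
    then have "glue 1 (0 # t') = 2 # r'" using Suc.prems(4) by (simp add: t glue_Cons_Cons)
    from glue_Cons_eq_Cons[OF this] show False by simp
  qed
  moreover have "a \<le> 1" using glue_Cons_eq_Cons[OF 0] by (simp split: if_splits)
  ultimately have a: "a = 1" by linarith
  obtain b t'' where t': "t' = b # t''"
    using 0 by (cases t'; cases i) (simp_all add: glue_singleton)
  have b': "b \<noteq> 1" "b \<le> 3" using Suc.prems t t' a by auto
  have 1: "glue 1 (1 # b # t'') = 1 # 2 # r'"
    using Suc.prems(4) by (simp add: t t' a glue_Cons_Cons)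
  have b0: "b \<noteq> 0"
  proof
    assume "b = 0"
    then have "glue 1 (0 # t'') = 2 # r'" using 1 by (simp add: glue_Cons_Cons)
    from glue_Cons_eq_Cons[OF this] show False by simp
  qed
  then have "glue 0 (1 # b # t'') = 0 # glue 0 (b # t'')"
    using b' glue_Cons_neq[of 1 0 b t''] by auto
  with 0 have 2: "glue 0 (b # t'') = alt 1 0 i @ 1 # 2 # r" by (simp add: t' a)
  obtain z where "alt 1 0 i @ 1 # 2 # r = 1 # z" by (cases i) simp_all
  with 2 have "glue 0 (b # t'') = 1 # z" by simp
  from glue_Cons_eq_Cons[OF this] b0 have b: "b = 2" by simp
  have 3: "glue 1 (2 # t'') = 1 # 2 # r'" using 1 b by (simp add: glue_Cons_Cons)
  have "distinct_adj (2 # t'')" "set t'' \<subseteq> {..3}" using Suc.prems by (simp_all add: t t' b)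
  from Suc.IH[OF this 2[unfolded b] 3] show ?case by (simp add: t t' a b)
qed

text \<open>A single merging suffices here: after merging \<open>0\<close> with \<open>1\<close>,
  the labels \<open>1\<close> and \<open>2\<close> of the image come only from \<open>2\<close> and
  \<open>3\<close>, so the oscillation can be read off letter by letter.\<close>

lemma glue_split_last:
  assumes "distinct_adj (3 # t)" "set t \<subseteq> {..3}" "glue 0 (3 # t) = alt 2 1 i @ 2 # r"
  shows "\<exists>t'. 3 # t = alt 3 2 i @ 3 # t'"
  using assms
proof (induction i arbitrary: t)
  case (Suc i)
  obtain a t' where t: "t = a # t'" using Suc.prems by (cases t) (auto simp: glue_singleton)
  have a': "a \<noteq> 3" "a \<le> 3" using Suc.prems t by auto
  then have "glue 0 (3 # a # t') = 2 # glue 0 (a # t')"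
    using glue_Cons_neq[of 3 0 a t'] by (cases "a = 0") auto
  with Suc.prems(3) have 0: "glue 0 (a # t') = 1 # alt 2 1 i @ 2 # r" by (simp add: t)
  have a: "a = 2" using glue_Cons_eq_Cons[OF 0] by (cases "a = 0") simp_all
  obtain b t'' where t': "t' = b # t''"
    using 0 by (cases t'; cases i) (simp_all add: a glue_singleton)
  have b': "b \<noteq> 2" "b \<le> 3" using Suc.prems t t' a by auto
  then have "glue 0 (2 # b # t'') = 1 # glue 0 (b # t'')"
    using glue_Cons_neq[of 2 0 b t''] by (cases "b = 0") auto
  with 0 have 1: "glue 0 (b # t'') = alt 2 1 i @ 2 # r" by (simp add: t' a)
  obtain z where "alt 2 1 i @ 2 # r = 2 # z" by (cases i) simp_all
  with 1 have "glue 0 (b # t'') = 2 # z" by simp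
  from glue_Cons_eq_Cons[OF this] have b: "b = 3" by (cases "b = 0") simp_all
  have "distinct_adj (3 # t'')" "set t'' \<subseteq> {..3}" using Suc.prems by (simp_all add: t t' b)
  from Suc.IH[OF this 1[unfolded b]] show ?case by (simp add: t t' a b)
qed simp

lemma remdups_adj_alt_Cons:
  "a \<noteq> b \<Longrightarrow> c \<noteq> a \<Longrightarrow> remdups_adj (a # alt b a i @ c # w) = a # alt b a i @ remdups_adj (c # w)"
  by (induction i) auto

lemma remdups_adj_alt_prefix:
  assumes "a \<noteq> b"
  shows "remdups_adj (alt a b i @ a # w) = alt a b i @ remdups_adj (a # w)"
proof (induction i)
  case (Suc i)
  obtain z where z: "alt a b i @ a # w = a # z" by (cases i) simp_all
  have "remdups_adj (alt a b (Suc i) @ a # w) = a # b # remdups_adj (alt a b i @ a # w)"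
    using assms by (simp add: z)
  then show ?case by (simp add: Suc)
qed simp

lemma glue_idem:
  assumes "set w \<subseteq> {..k}" "distinct_adj w"
  shows "glue k w = w"
proof -
  have "glue k w = relabel (\<lambda>i. i) w"
    unfolding glue_def by (rule relabel_cong) (use assms(1) in auto)
  then show ?thesis using assms(2) by (simp add: relabel_ident)
qed

lemma glue_eq_Cons: "\<exists>r. glue k (x # t) = (if x \<le> k then x else x - 1) # r"
proof -
  have "glue k (x # t) \<noteq> []" by (simp add: glue_def relabel_def)
  then obtain y r where "glue k (x # t) = y # r" by (cases "glue k (x # t)") auto
  with glue_Cons_eq_Cons[OF this] show ?thesis by blast
qed

text \<open>Isolates the first crossing from \<open>0\<close> to \<open>3\<close>. Comparing the
  three mergings excludes irregular jumps and forces the oscillations between \<open>1\<close> and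
  \<open>2\<close> and between \<open>2\<close> and \<open>3\<close> to have the same length as the
  one between \<open>0\<close> and \<open>1\<close>.\<close>

lemma glue_classify_step:
  assumes v: "distinct_adj v" "set v \<subseteq> {..3}" "v \<noteq> []" "hd v = 0"
    and g: "glue 0 v = glue 2 v" "glue 1 v = glue 2 v"
  shows "v = [0] \<or> (\<exists>t. v = 0 # 3 # t) \<or> (\<exists>i t. v = climb 3 i @ 3 # t)"
proof -
  \<comment> \<open>Merging \<open>0\<close> with \<open>1\<close> swallows the initial oscillation,
    whereas the other mergings leave it visible, by \<open>low\<close>.\<close>
  have low0: "glue 0 (0 # alt 1 0 i @ w) = glue 0 (0 # w)" for i w
    by (simp add: glue_def relabel_def)
  have low: "glue k (0 # alt 1 0 i @ y # w) = 0 # alt 1 0 i @ glue k (y # w)" if "k \<ge> 1" "y \<ge> 1" for k i y w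
    using that remdups_adj_alt_Cons[of 0 1 "if y \<le> k then y else y - 1" i "map (\<lambda>i. if i \<le> k then i else i - 1) w"]
    by (auto simp: glue_def relabel_def)
  obtain v' where v': "v = 0 # v'" using v by (cases v) auto
  have "\<exists>i. v = 0 # alt 1 0 i \<or> v = 0 # alt 1 0 i @ [1] \<or>
    (\<exists>c t. c \<in> {2, 3} \<and> (v = 0 # alt 1 0 i @ c # t \<or> v = 0 # alt 1 0 i @ 1 # c # t))"
    using v unfolding v' by (intro scan_low_labels) auto
  then obtain i where "v = 0 # alt 1 0 i \<or> v = 0 # alt 1 0 i @ [1] \<or>
    (\<exists>c t. c \<in> {2, 3} \<and> (v = 0 # alt 1 0 i @ c # t \<or> v = 0 # alt 1 0 i @ 1 # c # t))" ..
  then consider "v = 0 # alt 1 0 i \<or> v = 0 # alt 1 0 i @ [1]"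
    | c t where "c = 2 \<or> c = 3" "v = 0 # alt 1 0 i @ c # t"
    | c t where "c = 2 \<or> c = 3" "v = 0 # alt 1 0 i @ 1 # c # t"
    by blast
  then show ?thesis
  proof cases
    \<comment> \<open>The labels \<open>2\<close> and \<open>3\<close> are not met before the end:
      merging \<open>2\<close> with \<open>3\<close> changes nothing, while merging \<open>0\<close>
      with \<open>1\<close> leaves only \<open>[0]\<close>.\<close>
    case 1
    moreover have "set (alt 1 0 i) \<subseteq> {..2}" using set_alt[of 1 0 i] by (rule subset_trans) simp
    ultimately have "set v \<subseteq> {..2}" by auto
    then have "glue 2 v = v" using v by (intro glue_idem)
    moreover have "glue 0 v = [0]"
      using 1 low0[of i "[]"] low0[of i "[1]"] by (auto simp: glue_Cons_Cons glue_singleton)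
    ultimately show ?thesis using g by simp
  next
    \<comment> \<open>Here \<open>c\<close> directly follows a \<open>0\<close>. The label
      \<open>2\<close> would have different images under the last two mergings, so
      \<open>c = 3\<close>; then merging \<open>0\<close> with \<open>1\<close> gives a word
      beginning \<open>0, 2\<close>, which leaves no room for an oscillation.\<close>
    case (2 c t)
    have "glue 1 (c # t) = glue 2 (c # t)"
      using g(2) 2(1) low[of 1 c i t] low[of 2 c i t] unfolding 2(2) by auto
    moreover obtain r where "glue 1 (c # t) = (if c \<le> 1 then c else c - 1) # r"
      using glue_eq_Cons by blast
    moreover obtain r' where "glue 2 (c # t) = (if c \<le> 2 then c else c - 1) # r'"
      using glue_eq_Cons by blast
    ultimately have c: "c = 3" using 2(1) by auto
    obtain r'' where "glue 0 (3 # t) = 2 # r''" using glue_eq_Cons[of 0 3 t] by auto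
    then have "glue 0 v = 0 # 2 # r''"
      unfolding 2(2) low0 c using glue_Cons_neq[of 0 0 3 t] by simp
    then have "i = 0" using g(1) low[of 2 c i t] c unfolding 2(2) by (cases i) auto
    then show ?thesis using 2 c by simp
  next
    \<comment> \<open>Here \<open>c\<close> follows a \<open>1\<close>. After merging
      \<open>2\<close> with \<open>3\<close> the second letter is \<open>1\<close>, and the first
      merging agrees with this only for \<open>c = 2\<close>. The remaining two oscillations are
      then extracted one after the other.\<close>
    case (3 c t)
    obtain r where r: "glue 2 (c # t) = 2 # r" using glue_eq_Cons[of 2 c t] 3(1) by auto
    have g2: "glue 2 v = 0 # alt 1 0 i @ 1 # 2 # r"
      using 3(1) r glue_Cons_neq[of 1 2 c t] low[of 2 1 i "c # t"] unfolding 3(2) by auto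
    have "glue 0 v = glue 0 (0 # 1 # c # t)" unfolding 3(2) low0 ..
    also have "\<dots> = glue 0 (1 # c # t)" by (simp add: glue_Cons_Cons)
    also have "\<dots> = 0 # glue 0 (c # t)" using 3(1) glue_Cons_neq[of 1 0 c t] by auto
    finally have g0: "glue 0 v = 0 # glue 0 (c # t)" .
    obtain z where z: "alt 1 0 i @ 1 # 2 # r = 1 # z" by (cases i) simp_all
    have "glue 0 (c # t) = 1 # z" using g(1) g0 g2 z by simp
    from glue_Cons_eq_Cons[OF this] 3(1) have c: "c = 2" by auto
    have "glue 1 v = 0 # alt 1 0 i @ glue 1 (2 # t)"
      using low[of 1 1 i "c # t"] unfolding 3(2) c by (simp add: glue_Cons_Cons)
    then have g1: "glue 1 (2 # t) = 1 # 2 # r" using g(2) g2 by simp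
    have dt: "distinct_adj (2 # t)" "set t \<subseteq> {..3}"
      using v unfolding 3(2) c by (auto simp: distinct_adj_Cons distinct_adj_append_iff)
    obtain t' where t': "2 # t = alt 2 1 i @ 2 # 3 # t'"
      using glue_split_middle[OF dt _ g1] g(1) g0 g2 c by auto
    have pre: "glue 0 (alt 2 1 i @ 2 # w) = alt 1 0 i @ glue 0 (2 # w)"
      "glue 2 (alt 2 1 i @ 2 # w) = alt 2 1 i @ glue 2 (2 # w)" for w
      using remdups_adj_alt_prefix[of 1 0] remdups_adj_alt_prefix[of 2 1]
      by (simp_all add: glue_def relabel_def)
    have "glue 0 v = 0 # alt 1 0 i @ 1 # glue 0 (3 # t')"
      unfolding g0 c t' pre using glue_Cons_neq[of 2 0 3 t'] by simp
    moreover obtain r' where r': "glue 2 (2 # 3 # t') = 2 # r'"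
      using glue_eq_Cons[of 2 2 "3 # t'"] by auto
    have "glue 2 v = 0 # alt 1 0 i @ 1 # alt 2 1 i @ 2 # r'"
      using g2 r unfolding c t' pre r' by simp
    \<comment> \<open>Cancelling the common prefix of the two mergings transfers the oscillation
      between \<open>1\<close> and \<open>2\<close> to the part that begins with the first
      \<open>3\<close>.\<close>
    ultimately have gl: "glue 0 (3 # t') = alt 2 1 i @ 2 # r'" using g(1) by simp
    have "distinct_adj (2 # t)" "set (2 # t) \<subseteq> {..3}" using dt by auto
    then have dt': "distinct_adj (3 # t')" "set t' \<subseteq> {..3}"
      unfolding t' by (auto simp: distinct_adj_append_iff)
    obtain t'' where "3 # t' = alt 3 2 i @ 3 # t''" using glue_split_last[OF dt' gl] by auto
    then have "v = climb 3 i @ 3 # t''" unfolding 3(2) c t' climb_simps by simp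
    then show ?thesis by blast
  qed
qed

lemma enc_eq_Cons: "n > 0 \<Longrightarrow> \<exists>r. enc n s u = turn n s 0 # r"
proof (cases u)
  case (Cons a u')
  assume "n > 0"
  then have z: "\<exists>z. climb n i = 0 # z" for i by (auto simp: climb_def upt_rec)
  show ?thesis
  proof (cases a)
    case (Some i)
    then show ?thesis using z[of i] Cons by auto
  qed (use Cons in simp)
qed simp

text \<open>Induction on the length: the first crossing is cut off, the rest starts at the opposite
  extreme label, and its mergings still agree because those of the cut-off piece coincide. One code
  \<open>u\<close> thus serves both the word and its merging.\<close>

lemma glue_classify:
  assumes "distinct_adj v" "set v \<subseteq> {..3}" "v \<noteq> []" "hd v = turn 3 s 0"
    and "glue 0 v = glue 2 v" "glue 1 v = glue 2 v"
  shows "\<exists>u. v = enc 3 s u \<and> glue 2 v = enc 2 s u"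
  using assms
proof (induction v arbitrary: s rule: length_induct)
  case (1 v)
  \<comment> \<open>Reversing the labels if necessary gives a word that starts at \<open>0\<close>;
    \<open>turn 3 s\<close> is an involution, so \<open>v\<close> is recovered from it.\<close>
  define v' where "v' = map (turn 3 s) v"
  have v_eq: "v = map (turn 3 s) v'"
    unfolding v'_def map_map by (rule map_idI[symmetric]) (use 1(3) in \<open>auto simp: turn_turn\<close>)
  have set': "set v' \<subseteq> {..3}" using 1(3) by (auto simp: v'_def turn_def)
  have inj: "inj_on (turn 3 s) {..3}" by (auto simp: inj_on_def turn_def)
  have glue': "glue k v' = map (turn 2 s) (glue (turn 2 s k) v)" if "k \<le> 2" for k
    unfolding v'_def using that 1(3) by (rule glue_turn)
  have g: "glue k v = glue 2 v" if "k \<le> 2" for k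
  proof -
    have "k = 0 \<or> k = 1 \<or> k = 2" using that by linarith
    then show ?thesis using 1(6,7) by auto
  qed
  have t2: "turn 2 s k \<le> 2" if "k \<le> 2" for k using that by (simp add: turn_def)
  have "distinct_adj v'"
    unfolding v'_def by (rule distinct_adj_mapI[OF 1(2) inj_on_subset[OF inj 1(3)]])
  moreover have "v' \<noteq> []" "hd v' = 0" using 1(4,5) by (auto simp: v'_def hd_map turn_def)
  moreover have "glue 0 v' = glue 2 v'" "glue 1 v' = glue 2 v'"
    by (simp_all add: glue' g[OF t2] del: One_nat_def)
  ultimately consider "v' = [0]" | t where "v' = 0 # 3 # t" | i t where "v' = climb 3 i @ 3 # t"
    using glue_classify_step[of v'] set' by blast
  then show ?case
  proof cases
    case 1
    then have "v = enc 3 s []" by (simp add: v_eq)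
    moreover have "glue 2 v = enc 2 s []" by (simp add: v_eq 1 glue_singleton turn_def)
    ultimately show ?thesis by blast
  next
    case (2 t)
    let ?w = "map (turn 3 s) (3 # t)"
    have v: "v = turn 3 s 0 # ?w" by (simp add: v_eq 2)
    have gv: "glue k v = turn 2 s 0 # glue k ?w" if "k \<le> 2" for k
      using that glue_Cons_neq[of "turn 3 s 0" k "turn 3 s 3" "map (turn 3 s) t"]
      by (auto simp: v turn_def)
    have "glue 0 ?w = glue 2 ?w" "glue 1 ?w = glue 2 ?w"
      using gv[of 0] gv[of 1] gv[of 2] 1(6,7) by auto
    moreover have "length ?w < length v" "distinct_adj ?w" "set ?w \<subseteq> {..3}" "hd ?w = turn 3 (\<not> s) 0"
      using 1(2,3) unfolding v by (auto simp: turn_def)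
    ultimately obtain u where "?w = enc 3 (\<not> s) u" "glue 2 ?w = enc 2 (\<not> s) u"
      using 1(1) by (metis list.map_disc_iff list.distinct(1))
    then have "v = enc 3 s (None # u) \<and> glue 2 v = enc 2 s (None # u)"
      using gv[of 2] v by simp
    then show ?thesis by blast
  next
    case (3 i t)
    let ?w = "map (turn 3 s) (3 # t)"
    have v: "v = map (turn 3 s) (climb 3 i) @ ?w" by (simp add: v_eq 3)
    have w3: "set (3 # t) \<subseteq> {..3}" using set' by (simp add: 3)
    have gv: "glue k v = map (turn 2 s) (climb 2 i) @ glue k ?w" if "k \<le> 2" for k
    proof -
      have "glue k v = map (turn 2 s) (glue (turn 2 s k) (climb 3 i @ 3 # t))"
        unfolding v_eq 3 using that set'[unfolded 3] by (rule glue_turn)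
      also have "\<dots> = map (turn 2 s) (climb 2 i @ glue (turn 2 s k) (3 # t))"
        using t2[OF that] by (simp add: glue_climb)
      also have "\<dots> = map (turn 2 s) (climb 2 i) @ glue k ?w"
        unfolding glue_turn[OF that w3] by simp
      finally show ?thesis .
    qed
    have "glue 0 ?w = glue 2 ?w" "glue 1 ?w = glue 2 ?w"
      using gv[of 0] gv[of 1] gv[of 2] 1(6,7) by auto
    moreover have "length ?w < length v" by (simp add: v climb_simps)
    moreover have "distinct_adj ?w" using 1(2) unfolding v by (rule distinct_adj_appendD2)
    moreover have "set ?w \<subseteq> {..3}" using 1(3) unfolding v by simp
    moreover have "hd ?w = turn 3 (\<not> s) 0" by (simp add: turn_def)
    ultimately obtain u where "?w = enc 3 (\<not> s) u" "glue 2 ?w = enc 2 (\<not> s) u"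
      using 1(1) by (metis list.map_disc_iff list.distinct(1))
    then have "v = enc 3 s (Some i # u) \<and> glue 2 v = enc 2 s (Some i # u)"
      using gv[of 2] v by simp
    then show ?thesis by blast
  qed
qed

section \<open>Injectivity of the ternary encoding\<close>

lemma alt_cancel:
  assumes "a \<noteq> b" "alt m a i @ m # b # x = alt m a j @ m # b # y"
  shows "i = j"
  using assms(2)
proof (induction i arbitrary: j)
  case 0
  then show ?case using assms(1) by (cases j) auto
next
  case (Suc i)
  then show ?case using assms(1) by (cases j) auto
qed

text \<open>How to read the first code letter: the middle label \<open>1\<close>, fixed by
  \<open>turn 2 s\<close>, comes second only for \<open>Some i\<close>, and \<open>i\<close> is the
  number of returns to the starting label before the opposite one is first visited.\<close>

lemma enc2_cases:
  "u = [] \<Longrightarrow> enc 2 s u = [turn 2 s 0]"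
  "u = None # u' \<Longrightarrow> \<exists>r. enc 2 s u = turn 2 s 0 # turn 2 s 2 # r"
  "u = Some i # u' \<Longrightarrow>
     \<exists>r. enc 2 s u = turn 2 s 0 # alt 1 (turn 2 s 0) i @ 1 # turn 2 s 2 # r"
proof -
  obtain r where r: "enc 2 (\<not> s) u' = turn 2 s 2 # r"
    using enc_eq_Cons[of 2 "\<not> s" u'] by (auto simp: turn_def)
  show "u = None # u' \<Longrightarrow> \<exists>r. enc 2 s u = turn 2 s 0 # turn 2 s 2 # r"
    by (simp add: r)
  obtain z where z: "alt (turn 2 s 2) 1 i @ turn 2 s 2 # r = turn 2 s 2 # z"
    by (cases i) simp_all
  have "turn 2 s 1 = 1" by (simp add: turn_def)
  with z show "u = Some i # u' \<Longrightarrow>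
     \<exists>r. enc 2 s u = turn 2 s 0 # alt 1 (turn 2 s 0) i @ 1 # turn 2 s 2 # r"
    by (simp add: r climb_simps)
qed simp

text \<open>The first label determines \<open>s\<close> and the beginning of the word determines the
  first code letter; then the common piece is cancelled. For R this amounts to uniqueness of normal
  forms.\<close>

lemma enc2_inj: "enc 2 s u = enc 2 s' u' \<Longrightarrow> s = s' \<and> u = u'"
proof (induction u arbitrary: s s' u')
  case (Nil s s' u')
  obtain r where "enc 2 s' u' = turn 2 s' 0 # r" using enc_eq_Cons[of 2 s' u'] by auto
  with Nil have s: "s = s'" by (auto simp: turn_def split: if_splits)
  have "u' = []"
  proof (cases u')
    case (Cons a u'')
    then show ?thesis using Nil enc2_cases(2)[of u' u'' s'] enc2_cases(3)[where u = u' and u' = u'' and s = s'] by (cases a) fastforce+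
  qed simp
  with s show ?case by simp
next
  case (Cons a u s s' u')
  obtain r r' where "enc 2 s' u' = turn 2 s' 0 # r" "enc 2 s (a # u) = turn 2 s 0 # r'"
    using enc_eq_Cons[of 2] by (meson zero_less_numeral)
  with Cons.prems have s: "s' = s" by (auto simp: turn_def split: if_splits)
  have ne: "turn 2 s 0 \<noteq> 1" "turn 2 s 2 \<noteq> 1" "turn 2 s 0 \<noteq> turn 2 s 2" by (auto simp: turn_def)
  have alt_hd: "\<exists>z. alt 1 b i @ 1 # w = 1 # z" for b i w by (cases i) simp_all
  have two: "\<exists>r. enc 2 s (None # u) = turn 2 s 0 # turn 2 s 2 # r"
    "\<exists>r. enc 2 s (Some i # u) = turn 2 s 0 # 1 # r" for u i
    using enc2_cases(2)[of "None # u" u s] enc2_cases(3)[where u = "Some i # u" and i = i and u' = u and s = s] alt_hd by fastforce+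
  show ?case
  proof (cases u')
    case Nil
    moreover have "\<exists>y r. enc 2 s (a # u) = turn 2 s 0 # y # r"
    proof (cases a)
      case (Some i)
      then show ?thesis using two(2)[where i = i and u = u] by auto
    qed (use two(1)[of u] in auto)
    ultimately show ?thesis using Cons.prems by auto
  next
    case u': (Cons a' u'')
    show ?thesis
    proof (cases a; cases a')
      assume a: "a = None" "a' = None"
      then have "enc 2 (\<not> s) u = enc 2 (\<not> s) u''" using Cons.prems by (simp add: u' s)
      then show ?thesis using Cons.IH a u' s by blast
    next
      fix i assume a: "a = None" "a' = Some i"
      then show ?thesis using Cons.prems two(1)[of u] two(2)[where i = i and u = u''] ne by (auto simp: u' s simp del: enc.simps)
    next
      fix i assume a: "a = Some i" "a' = None"
      then show ?thesis using Cons.prems two(1)[of u''] two(2)[where i = i and u = u] ne by (auto simp: u' s simp del: enc.simps)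
    next
      fix i j assume a: "a = Some i" "a' = Some j"
      obtain r where r: "enc 2 s (a # u) = turn 2 s 0 # alt 1 (turn 2 s 0) i @ 1 # turn 2 s 2 # r"
        using enc2_cases(3)[where u = "a # u" and i = i and u' = u and s = s] a by auto
      obtain r' where r': "enc 2 s u' = turn 2 s 0 # alt 1 (turn 2 s 0) j @ 1 # turn 2 s 2 # r'"
        using enc2_cases(3)[where u = u' and i = j and u' = u'' and s = s] a u' by auto
      have "i = j"
        using alt_cancel[of "turn 2 s 0" "turn 2 s 2" 1 i r j r'] Cons.prems r r' ne s
        by (simp del: enc.simps)
      then have "enc 2 (\<not> s) u = enc 2 (\<not> s) u''" using Cons.prems a by (simp add: u' s)
      then show ?thesis using Cons.IH a u' s \<open>i = j\<close> by blast
    qed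
  qed
qed

section \<open>Label words of elements of a cosemigroup\<close>

definition lab1 :: "('a \<Rightarrow> (nat \<times> 'a) list) \<Rightarrow> 'a \<Rightarrow> nat list" where
  "lab1 \<beta> x = fp_lift labw (\<lambda>i _. [i]) (\<beta> x)"

text \<open>The second application expands the letters from copy \<open>0\<close>. Expanding those
  from copy \<open>1\<close> gives the same word by coassociativity, see \<open>lab2_alt\<close>;
  likewise \<open>lab3_alt\<close> for \<open>lab3\<close>.\<close>

definition lab2 :: "('a \<Rightarrow> (nat \<times> 'a) list) \<Rightarrow> 'a \<Rightarrow> nat list" where
  "lab2 \<beta> x = fp_lift labw (\<lambda>i y. if i = 0 then lab1 \<beta> y else [2]) (\<beta> x)"

definition lab3 :: "('a \<Rightarrow> (nat \<times> 'a) list) \<Rightarrow> 'a \<Rightarrow> nat list" where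
  "lab3 \<beta> x = fp_lift labw (\<lambda>i y. if i = 0 then lab2 \<beta> y else [3]) (\<beta> x)"

lemma const_hom_labw: "(\<lambda>_. [i]) \<in> hom S labw"
  by (auto simp: hom_def)

lemma cosemigroupD:
  assumes "is_cosemigroup S \<beta>"
  shows "is_semigroup S" "\<beta> \<in> hom S (cop2 S)" "x \<in> carrier S \<Longrightarrow> \<beta> x \<in> fp_carrier {0, 1} (\<lambda>_. S)"
proof -
  show "is_semigroup S" and hom: "\<beta> \<in> hom S (cop2 S)" using assms by (simp_all add: is_cosemigroup_def)
  show "x \<in> carrier S \<Longrightarrow> \<beta> x \<in> fp_carrier {0, 1} (\<lambda>_. S)"
    using hom_in_carrier[OF hom] by simp
qed

text \<open>The map is the product of \<open>F 0\<close> and \<open>F 1\<close> in Hom(S,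
  A).\<close>

lemma lift_comp_hom:
  assumes "\<beta> \<in> hom S (cop2 S)" "is_semigroup A" "\<And>i. i \<in> {0, 1} \<Longrightarrow> F i \<in> hom S A"
  shows "(\<lambda>x. fp_lift A F (\<beta> x)) \<in> hom S A"
proof -
  have "fp_lift A F \<in> hom (cop2 S) A" using assms(2,3) by (rule fp_lift_hom)
  from hom_compose[OF assms(1) this] show ?thesis by (simp add: comp_def)
qed

text \<open>Associativity of the multiplication on Hom(S, A) for the product of \<open>F 0\<close>,
  \<open>F 1\<close> and \<open>F 2\<close>: the homomorphism from the threefold coproduct induced
  by \<open>F\<close> is applied to the coassociativity equation.\<close>

lemma cosemigroup_coassoc:
  assumes cs: "is_cosemigroup S \<beta>" and A: "is_semigroup A" and F: "\<And>i. i \<in> {0, 1, 2} \<Longrightarrow> F i \<in> hom S A"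
    and x: "x \<in> carrier S"
  shows "fp_lift A (\<lambda>i y. if i = 0 then fp_lift A F (\<beta> y) else F 2 y) (\<beta> x) =
    fp_lift A (\<lambda>i y. if i = 0 then F 0 y else fp_lift A (\<lambda>j. F (j + 1)) (\<beta> y)) (\<beta> x)"
proof -
  note sg = cosemigroupD(1)[OF cs] and bx = cosemigroupD(3)[OF cs]
  have sg3: "is_semigroup (cop3 S)" using sg by (rule free_prod_semigroup)
  have H: "fp_lift A F \<in> hom (cop3 S) A" using A F by (rule fp_lift_hom)
  have fp_in3: "fp_in i \<in> hom S (cop3 S)" if "i \<in> {0, 1, 2}" for i :: nat
    using that sg by (rule fp_in_hom)
  have in3: "fp_in i y \<in> carrier (cop3 S)" if "i \<in> {0, 1, 2}" "y \<in> carrier S" for i y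
    using hom_in_carrier[OF fp_in3] that by blast
  \<comment> \<open>The offsets \<open>d = 0\<close> and \<open>d = 1\<close> cover the embeddings
    of the twofold coproduct as the first two and as the last two copies.\<close>
  have in3': "fp_lift (cop3 S) (\<lambda>j. fp_in (j + d)) (\<beta> y) \<in> carrier (cop3 S)"
    if "d \<in> {0, 1}" "y \<in> carrier S" for d y
  proof -
    have "(\<lambda>y. fp_lift (cop3 S) (\<lambda>j. fp_in (j + d)) (\<beta> y)) \<in> hom S (cop3 S)"
      using cosemigroupD(2)[OF cs] sg3 by (rule lift_comp_hom) (rule fp_in3, use that(1) in auto)
    from hom_in_carrier[OF this that(2)] show ?thesis .
  qed
  have H': "fp_lift A F (fp_lift (cop3 S) (\<lambda>j. fp_in (j + d)) (\<beta> y)) = fp_lift A (\<lambda>j. F (j + d)) (\<beta> y)"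
    if "d \<in> {0, 1}" "y \<in> carrier S" for d y
  proof -
    have "fp_lift A F (fp_lift (cop3 S) (\<lambda>j. fp_in (j + d)) (\<beta> y)) =
        fp_lift A (\<lambda>j z. fp_lift A F (fp_in (j + d) z)) (\<beta> y)"
      using sg3 H bx[OF that(2)] by (rule hom_fp_lift) (rule in3, use that(1) in auto)
    then show ?thesis by simp
  qed
  have "fp_lift A F (fp_lift (cop3 S)
          (\<lambda>i y. if i = 0 then fp_lift (cop3 S) (\<lambda>j z. fp_in j z) (\<beta> y) else fp_in 2 y) (\<beta> x)) =
      fp_lift A (\<lambda>i y. fp_lift A F
        (if i = 0 then fp_lift (cop3 S) (\<lambda>j z. fp_in j z) (\<beta> y) else fp_in 2 y)) (\<beta> x)"
    using sg3 H bx[OF x] by (rule hom_fp_lift) (use in3[of 2] in3'[of 0] in auto)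
  also have "\<dots> = fp_lift A (\<lambda>i y. if i = 0 then fp_lift A F (\<beta> y) else F 2 y) (\<beta> x)"
    using bx[OF x] by (rule fp_lift_cong) (use H'[of 0] in auto)
  finally have L: "fp_lift A F (fp_lift (cop3 S)
          (\<lambda>i y. if i = 0 then fp_lift (cop3 S) (\<lambda>j z. fp_in j z) (\<beta> y) else fp_in 2 y) (\<beta> x)) = \<dots>" .
  have "fp_lift A F (fp_lift (cop3 S)
          (\<lambda>i y. if i = 0 then fp_in 0 y else fp_lift (cop3 S) (\<lambda>j z. fp_in (j + 1) z) (\<beta> y)) (\<beta> x)) =
      fp_lift A (\<lambda>i y. fp_lift A F
        (if i = 0 then fp_in 0 y else fp_lift (cop3 S) (\<lambda>j z. fp_in (j + 1) z) (\<beta> y))) (\<beta> x)"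
    using sg3 H bx[OF x] by (rule hom_fp_lift) (use in3[of 0] in3'[of 1] in auto)
  also have "\<dots> = fp_lift A (\<lambda>i y. if i = 0 then F 0 y else fp_lift A (\<lambda>j. F (j + 1)) (\<beta> y)) (\<beta> x)"
    using bx[OF x] by (rule fp_lift_cong) (use H'[of 1] in auto)
  finally have R: "fp_lift A F (fp_lift (cop3 S)
          (\<lambda>i y. if i = 0 then fp_in 0 y else fp_lift (cop3 S) (\<lambda>j z. fp_in (j + 1) z) (\<beta> y)) (\<beta> x)) = \<dots>" .
  show ?thesis unfolding L[symmetric] R[symmetric] using cs x by (simp add: is_cosemigroup_def)
qed

lemma lab1_hom: "is_cosemigroup S \<beta> \<Longrightarrow> lab1 \<beta> \<in> hom S labw"
  unfolding lab1_def
  by (rule lift_comp_hom[OF cosemigroupD(2) labw_semigroup]) (auto simp: const_hom_labw)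

lemma lab2_hom: "is_cosemigroup S \<beta> \<Longrightarrow> lab2 \<beta> \<in> hom S labw"
  unfolding lab2_def
  by (rule lift_comp_hom[OF cosemigroupD(2) labw_semigroup]) (auto simp: const_hom_labw lab1_hom)

lemma lab3_hom: "is_cosemigroup S \<beta> \<Longrightarrow> lab3 \<beta> \<in> hom S labw"
  unfolding lab3_def
  by (rule lift_comp_hom[OF cosemigroupD(2) labw_semigroup]) (auto simp: const_hom_labw lab2_hom)

lemma relabel_hom_compose: "h \<in> hom S labw \<Longrightarrow> (\<lambda>x. relabel f (h x)) \<in> hom S labw"
  using hom_compose[of h S labw "relabel f" labw] relabel_hom by (simp add: comp_def)

lemma relabel_lift:
  assumes "w \<in> fp_carrier I S" "\<And>i x. i \<in> I \<Longrightarrow> x \<in> carrier (S i) \<Longrightarrow> F i x \<in> carrier labw"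
  shows "relabel f (fp_lift labw F w) = fp_lift labw (\<lambda>i x. relabel f (F i x)) w"
  using labw_semigroup relabel_hom assms by (rule hom_fp_lift)

text \<open>Coassociativity for the three constant maps with values \<open>[0]\<close>,
  \<open>[1]\<close> and \<open>[2]\<close>.\<close>

lemma lab2_alt:
  assumes cs: "is_cosemigroup S \<beta>" and x: "x \<in> carrier S"
  shows "lab2 \<beta> x = fp_lift labw (\<lambda>i y. if i = 0 then [0] else relabel Suc (lab1 \<beta> y)) (\<beta> x)"
proof -
  have "lab2 \<beta> x = fp_lift labw (\<lambda>i y. if i = 0 then [0] else fp_lift labw (\<lambda>j _. [j + 1]) (\<beta> y)) (\<beta> x)"
    using cosemigroup_coassoc[OF cs labw_semigroup const_hom_labw x, of "\<lambda>i. i"]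
    unfolding lab2_def lab1_def .
  also have "\<dots> = fp_lift labw (\<lambda>i y. if i = 0 then [0] else relabel Suc (lab1 \<beta> y)) (\<beta> x)"
    using cosemigroupD(3)[OF cs x]
  proof (rule fp_lift_cong)
    fix i :: nat and y assume y: "y \<in> carrier S"
    have "relabel Suc (lab1 \<beta> y) = fp_lift labw (\<lambda>i _. relabel Suc [i]) (\<beta> y)"
      unfolding lab1_def using cosemigroupD(3)[OF cs y] by (rule relabel_lift) auto
    then show "(if i = 0 then [0] else fp_lift labw (\<lambda>j _. [j + 1]) (\<beta> y)) =
        (if i = 0 then [0] else relabel Suc (lab1 \<beta> y))"
      by (simp add: relabel_def)
  qed
  finally show ?thesis .
qed

lemma lab3_alt:
  assumes cs: "is_cosemigroup S \<beta>" and x: "x \<in> carrier S"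
  shows "lab3 \<beta> x = fp_lift labw (\<lambda>i y. if i = 0 then [0] else relabel Suc (lab2 \<beta> y)) (\<beta> x)"
proof -
  \<comment> \<open>Chosen so that the left bracketing yields \<open>lab2\<close>, in the form of
    \<open>lab2_alt\<close>, on copy \<open>0\<close>, and the right bracketing yields
    \<open>lab2\<close> with all labels shifted by one on copy \<open>1\<close>.\<close>
  let ?F = "\<lambda>(i :: nat) y. if i = 0 then [0] else if i = 1 then relabel Suc (lab1 \<beta> y) else [3]"
  have F: "?F i \<in> hom S labw" for i :: nat
    using relabel_hom_compose[OF lab1_hom[OF cs], of Suc] const_hom_labw
    by (cases "i = 0"; cases "i = 1") simp_all
  note c1 = hom_in_carrier[OF lab1_hom[OF cs]]
  have "lab3 \<beta> x = fp_lift labw (\<lambda>i y. if i = 0 then fp_lift labw ?F (\<beta> y) else ?F 2 y) (\<beta> x)"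
    unfolding lab3_def using cosemigroupD(3)[OF cs x]
  proof (rule fp_lift_cong)
    fix i :: nat and y assume y: "y \<in> carrier S"
    have "lab2 \<beta> y = fp_lift labw ?F (\<beta> y)"
      unfolding lab2_alt[OF cs y] using cosemigroupD(3)[OF cs y] by (rule fp_lift_cong) auto
    then show "(if i = 0 then lab2 \<beta> y else [3]) = (if i = 0 then fp_lift labw ?F (\<beta> y) else ?F 2 y)"
      by simp
  qed
  also have "\<dots> = fp_lift labw (\<lambda>i y. if i = 0 then ?F 0 y else fp_lift labw (\<lambda>j. ?F (j + 1)) (\<beta> y)) (\<beta> x)"
    using cs labw_semigroup F x by (rule cosemigroup_coassoc)
  also have "\<dots> = fp_lift labw (\<lambda>i y. if i = 0 then [0] else relabel Suc (lab2 \<beta> y)) (\<beta> x)"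
    using cosemigroupD(3)[OF cs x]
  proof (rule fp_lift_cong)
    fix i :: nat and y assume y: "y \<in> carrier S"
    have "relabel Suc (lab2 \<beta> y) =
        fp_lift labw (\<lambda>i y. relabel Suc (if i = 0 then lab1 \<beta> y else [2])) (\<beta> y)"
      unfolding lab2_def using cosemigroupD(3)[OF cs y]
      by (rule relabel_lift) (use c1 in auto)
    also have "\<dots> = fp_lift labw (\<lambda>j. ?F (j + 1)) (\<beta> y)"
      using cosemigroupD(3)[OF cs y] by (rule fp_lift_cong) (auto simp: relabel_def)
    finally show "(if i = 0 then ?F 0 y else fp_lift labw (\<lambda>j. ?F (j + 1)) (\<beta> y)) =
        (if i = 0 then [0] else relabel Suc (lab2 \<beta> y))"
      by simp
  qed
  finally show ?thesis .
qed

lemma set_lift_labw: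
  assumes "w \<in> fp_carrier I S" "\<And>i x. i \<in> I \<Longrightarrow> x \<in> carrier (S i) \<Longrightarrow> F i x \<in> carrier labw \<and> set (F i x) \<subseteq> N"
  shows "set (fp_lift labw F w) \<subseteq> N"
proof -
  have "lprod labw (map (\<lambda>l. F (fst l) (snd l)) w) = remdups_adj (concat (map (\<lambda>l. F (fst l) (snd l)) w))"
    using assms by (intro lprod_labw) (auto simp: fp_carrier_iff)
  then show ?thesis using assms by (fastforce simp: fp_lift_def fp_carrier_iff)
qed

lemma set_lab1: "is_cosemigroup S \<beta> \<Longrightarrow> x \<in> carrier S \<Longrightarrow> set (lab1 \<beta> x) \<subseteq> {..1}"
  unfolding lab1_def using cosemigroupD(3) by (rule set_lift_labw) auto

lemma set_lab2:
  assumes cs: "is_cosemigroup S \<beta>" and x: "x \<in> carrier S"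
  shows "set (lab2 \<beta> x) \<subseteq> {..2}"
  unfolding lab2_def using cosemigroupD(3)[OF cs x]
proof (rule set_lift_labw)
  fix i :: nat and y assume "y \<in> carrier S"
  then have "lab1 \<beta> y \<in> carrier labw" "set (lab1 \<beta> y) \<subseteq> {..1}"
    using set_lab1[OF cs] hom_in_carrier[OF lab1_hom[OF cs]] by blast+
  moreover have "{..1} \<subseteq> {..2::nat}" by auto
  ultimately show "(if i = 0 then lab1 \<beta> y else [2]) \<in> carrier labw \<and>
      set (if i = 0 then lab1 \<beta> y else [2]) \<subseteq> {..2}"
    by (cases "i = 0") (auto intro: subset_trans)
qed

lemma set_lab3:
  assumes cs: "is_cosemigroup S \<beta>" and x: "x \<in> carrier S"
  shows "set (lab3 \<beta> x) \<subseteq> {..3}"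
  unfolding lab3_def using cosemigroupD(3)[OF cs x]
proof (rule set_lift_labw)
  fix i :: nat and y assume "y \<in> carrier S"
  then have "lab2 \<beta> y \<in> carrier labw" "set (lab2 \<beta> y) \<subseteq> {..2}"
    using set_lab2[OF cs] hom_in_carrier[OF lab2_hom[OF cs]] by blast+
  moreover have "{..2} \<subseteq> {..3::nat}" by auto
  ultimately show "(if i = 0 then lab2 \<beta> y else [3]) \<in> carrier labw \<and>
      set (if i = 0 then lab2 \<beta> y else [3]) \<subseteq> {..3}"
    by (cases "i = 0") (auto intro: subset_trans)
qed

text \<open>Merging \<open>0\<close> with \<open>1\<close> undoes the expansion of copy
  \<open>0\<close>, and merging \<open>1\<close> with \<open>2\<close> undoes that of copy
  \<open>1\<close> in \<open>lab2_alt\<close>: each inserted word collapses to a single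
  label.\<close>

lemma glue_lab2:
  assumes cs: "is_cosemigroup S \<beta>" and x: "x \<in> carrier S"
  shows "glue 0 (lab2 \<beta> x) = lab1 \<beta> x" "glue 1 (lab2 \<beta> x) = lab1 \<beta> x"
proof -
  have c1: "lab1 \<beta> y \<noteq> []" "distinct_adj (lab1 \<beta> y)" if "y \<in> carrier S" for y
    using hom_in_carrier[OF lab1_hom[OF cs] that] by auto
  have "glue 0 (lab2 \<beta> x) = fp_lift labw (\<lambda>i y. glue 0 (if i = 0 then lab1 \<beta> y else [2])) (\<beta> x)"
    unfolding glue_def lab2_def using cosemigroupD(3)[OF cs x] by (rule relabel_lift) (auto simp: c1)
  also have "\<dots> = fp_lift labw (\<lambda>i _. [i]) (\<beta> x)"
    using cosemigroupD(3)[OF cs x]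
  proof (rule fp_lift_cong)
    fix i :: nat and y assume "i \<in> {0, 1}" and y: "y \<in> carrier S"
    have "glue 0 (lab1 \<beta> y) = relabel (\<lambda>_. 0) (lab1 \<beta> y)"
      unfolding glue_def using set_lab1[OF cs y] by (intro relabel_cong) auto
    also have "\<dots> = [0]" using c1[OF y] by (simp add: relabel_const)
    finally show "glue 0 (if i = 0 then lab1 \<beta> y else [2]) = [i]"
      using \<open>i \<in> {0, 1}\<close> by (auto simp: glue_singleton)
  qed
  finally show "glue 0 (lab2 \<beta> x) = lab1 \<beta> x" by (simp add: lab1_def)
  have "glue 1 (lab2 \<beta> x) = fp_lift labw (\<lambda>i y. glue 1 (if i = 0 then [0] else relabel Suc (lab1 \<beta> y))) (\<beta> x)"
    unfolding glue_def lab2_alt[OF cs x] using cosemigroupD(3)[OF cs x]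
    by (rule relabel_lift) (auto simp: c1 relabel_def)
  also have "\<dots> = fp_lift labw (\<lambda>i _. [i]) (\<beta> x)"
    using cosemigroupD(3)[OF cs x]
  proof (rule fp_lift_cong)
    fix i :: nat and y assume "i \<in> {0, 1}" and y: "y \<in> carrier S"
    have "glue 1 (relabel Suc (lab1 \<beta> y)) = relabel (\<lambda>_. 1) (lab1 \<beta> y)"
      unfolding glue_def relabel_relabel using set_lab1[OF cs y] by (intro relabel_cong) auto
    also have "\<dots> = [1]" using c1[OF y] by (simp add: relabel_const)
    finally show "glue 1 (if i = 0 then [0] else relabel Suc (lab1 \<beta> y)) = [i]"
      using \<open>i \<in> {0, 1}\<close> by (auto simp: glue_singleton)
  qed
  finally show "glue 1 (lab2 \<beta> x) = lab1 \<beta> x" by (simp add: lab1_def)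
qed

text \<open>For \<open>k < 2\<close> the merging takes place inside the words \<open>lab2\<close> of
  the letters from copy \<open>0\<close>, where \<open>glue_lab2\<close> applies; for
  \<open>k = 2\<close> the expansion of copy \<open>1\<close> from \<open>lab3_alt\<close> is used
  instead.\<close>

lemma glue_lab3:
  assumes cs: "is_cosemigroup S \<beta>" and x: "x \<in> carrier S" and k: "k \<le> 2"
  shows "glue k (lab3 \<beta> x) = lab2 \<beta> x"
proof -
  have c2: "lab2 \<beta> y \<noteq> []" "distinct_adj (lab2 \<beta> y)" if "y \<in> carrier S" for y
    using hom_in_carrier[OF lab2_hom[OF cs] that] by auto
  show ?thesis
  proof (cases "k = 2")
    case False
    have "glue k (lab3 \<beta> x) = fp_lift labw (\<lambda>i y. glue k (if i = 0 then lab2 \<beta> y else [3])) (\<beta> x)"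
      unfolding glue_def lab3_def using cosemigroupD(3)[OF cs x] by (rule relabel_lift) (auto simp: c2)
    also have "\<dots> = fp_lift labw (\<lambda>i y. if i = 0 then lab1 \<beta> y else [2]) (\<beta> x)"
      using cosemigroupD(3)[OF cs x]
    proof (rule fp_lift_cong)
      fix i :: nat and y assume y: "y \<in> carrier S"
      have "k = 0 \<or> k = 1" using k False by linarith
      then have "glue k (lab2 \<beta> y) = lab1 \<beta> y" using glue_lab2[OF cs y] by auto
      then show "glue k (if i = 0 then lab2 \<beta> y else [3]) = (if i = 0 then lab1 \<beta> y else [2])"
        using k by (auto simp: glue_singleton)
    qed
    finally show ?thesis by (simp add: lab2_def)
  next
    case True
    have "glue 2 (lab3 \<beta> x) = fp_lift labw (\<lambda>i y. glue 2 (if i = 0 then [0] else relabel Suc (lab2 \<beta> y))) (\<beta> x)"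
      unfolding glue_def lab3_alt[OF cs x] using cosemigroupD(3)[OF cs x]
      by (rule relabel_lift) (auto simp: c2 relabel_def)
    also have "\<dots> = lab2 \<beta> x"
      unfolding lab2_alt[OF cs x] using cosemigroupD(3)[OF cs x]
    proof (rule fp_lift_cong)
      fix i :: nat and y assume y: "y \<in> carrier S"
      have "glue 2 (relabel Suc (lab2 \<beta> y)) = relabel Suc (glue 1 (lab2 \<beta> y))"
        unfolding glue_def relabel_relabel by (intro relabel_cong) auto
      then show "glue 2 (if i = 0 then [0] else relabel Suc (lab2 \<beta> y)) =
          (if i = 0 then [0] else relabel Suc (lab1 \<beta> y))"
        using glue_lab2(2)[OF cs y] by (auto simp: glue_singleton)
    qed
    finally show ?thesis using True by simp
  qed
qed

lemma lab3_enc: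
  assumes cs: "is_cosemigroup S \<beta>" and x: "x \<in> carrier S"
  shows "\<exists>s u. lab3 \<beta> x = enc 3 s u \<and> lab2 \<beta> x = enc 2 s u"
proof -
  have c3: "lab3 \<beta> x \<noteq> []" "distinct_adj (lab3 \<beta> x)"
    using hom_in_carrier[OF lab3_hom[OF cs] x] by auto
  obtain a v where v: "lab3 \<beta> x = a # v" using c3 by (cases "lab3 \<beta> x") auto
  have g: "glue k (lab3 \<beta> x) = lab2 \<beta> x" if "k \<le> 2" for k using cs x that by (rule glue_lab3)
  obtain b w where w: "lab2 \<beta> x = b # w"
    using hom_in_carrier[OF lab2_hom[OF cs] x] by (cases "lab2 \<beta> x") auto
  \<comment> \<open>All three mergings have the same first letter \<open>b\<close>; the labels
    \<open>1\<close> and \<open>2\<close> do not have equal images under the three mergings, so the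
    word starts at an extreme label.\<close>
  have "b = (if a \<le> k then a else a - 1)" if "k \<le> 2" for k
    using glue_Cons_eq_Cons[of k a v b w] g[OF that] v w by simp
  from this[of 0] this[of 1] this[of 2] have "a \<noteq> 1" "a \<noteq> 2" by auto
  moreover have "a \<le> 3" using set_lab3[OF cs x] v by simp
  ultimately have "a = 0 \<or> a = 3" by linarith
  then obtain s where "hd (lab3 \<beta> x) = turn 3 s 0"
    by (metis v list.sel(1) turn_def diff_zero)
  from glue_classify[OF c3(2) set_lab3[OF cs x] c3(1) this] g[of 0] g[of 1] g[of 2]
  show ?thesis by auto
qed

section \<open>Recovering an element of the coproduct from its label words\<close>

lemma lift_labw_fst:
  "w \<in> fp_carrier I S \<Longrightarrow> fp_lift labw (\<lambda>i _. [i]) w = map fst w"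
proof -
  assume w: "w \<in> fp_carrier I S"
  have "concat (map (\<lambda>l. [fst l]) w) = map fst w" by (induction w) auto
  then show ?thesis
    using w unfolding fp_lift_def
    by (subst lprod_labw) (auto simp: fp_carrier_iff distinct_adj_altdef)
qed

text \<open>Neighbouring blocks belong to different copies and so share no label; hence nothing
  collapses when the blocks are multiplied in \<open>labw\<close>.\<close>

lemma distinct_adj_concat_blocks:
  assumes "distinct_adj (map fst w)" "\<And>l. l \<in> set w \<Longrightarrow> B l \<noteq> [] \<and> distinct_adj (B l)"
    and "\<And>l l'. l \<in> set w \<Longrightarrow> l' \<in> set w \<Longrightarrow> fst l \<noteq> fst l' \<Longrightarrow> set (B l) \<inter> set (B l') = {}"
  shows "distinct_adj (concat (map B w))"
  using assms
proof (induction w)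
  case (Cons l w)
  show ?case
  proof (cases w)
    case (Cons l' w')
    have "distinct_adj (concat (map B w))"
      using Cons.prems by (intro Cons.IH) (auto simp: distinct_adj_Cons)
    moreover have "set (B l) \<inter> set (B l') = {}" using Cons.prems(1,3) Cons by auto
    then have "last (B l) \<noteq> hd (concat (map B w))"
      using Cons.prems(2) Cons by (metis (no_types, lifting) concat.simps(2) disjoint_iff hd_append2
          hd_in_set last_in_set list.set_intros list.simps(9))
    ultimately show ?thesis using Cons.prems(2) by (simp add: distinct_adj_append_iff)
  qed (use Cons.prems in simp)
qed simp

text \<open>The label \<open>c\<close> acts as a separator: a block of copy \<open>j\<close> avoids
  it and, as copies alternate, is followed by the block \<open>[c]\<close> or by the end of the
  word.\<close>

lemma concat_blocks_eq:
  assumes "map fst a = map fst b" "distinct_adj (map fst a)" "concat (map B a) = concat (map B b)"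
    and "\<And>l. l \<in> set a \<union> set b \<Longrightarrow> B l \<noteq> []"
    and "\<And>l. l \<in> set a \<union> set b \<Longrightarrow> fst l = j \<Longrightarrow> c \<notin> set (B l)"
    and "\<And>l. l \<in> set a \<union> set b \<Longrightarrow> fst l \<noteq> j \<Longrightarrow> B l = [c]"
  shows "map B a = map B b"
  using assms
proof (induction a arbitrary: b)
  case (Cons l a)
  then obtain m b' where b: "b = m # b'" "fst m = fst l" "map fst a = map fst b'" by (cases b) auto
  have eq: "B l @ concat (map B a) = B m @ concat (map B b')" using Cons.prems(3) b by simp
  have "B l = B m"
  proof (cases "fst l = j")
    case True
    \<comment> \<open>Stated for an arbitrary \<open>n # e\<close> so that it cuts off the first
      block in both words.\<close>
    have tw: "takeWhile (\<lambda>k. k \<noteq> c) (B n @ concat (map B e)) = B n"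
      if "n # e = l # a \<or> n # e = b" for n e
    proof -
      have n: "c \<notin> set (B n)" "fst n = j" using Cons.prems(5)[of n] that True b by auto
      have "takeWhile (\<lambda>k. k \<noteq> c) (concat (map B e)) = []"
      proof (cases e)
        case (Cons l' e')
        have "distinct_adj (map fst (n # e))" using that Cons.prems(1,2) by auto
        then have "fst l' \<noteq> j" using Cons n by auto
        moreover have "l' \<in> set (l # a) \<union> set b" using that Cons by auto
        ultimately have "B l' = [c]" using Cons.prems(6) by blast
        then show ?thesis using Cons by simp
      qed simp
      moreover have "takeWhile (\<lambda>k. k \<noteq> c) (B n @ z) = B n @ takeWhile (\<lambda>k. k \<noteq> c) z" for z
        using n(1) by (intro takeWhile_append2) auto
      ultimately show ?thesis by simp
    qed
    show ?thesis using tw[of l a] tw[of m b'] eq b(1) by simp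
  next
    case False
    then show ?thesis using Cons.prems(6)[of l] Cons.prems(6)[of m] b by auto
  qed
  moreover have "map B a = map B b'"
  proof (rule Cons.IH)
    show "map fst a = map fst b'" by (rule b(3))
    show "distinct_adj (map fst a)" using Cons.prems(2) by (auto simp: distinct_adj_Cons)
    show "concat (map B a) = concat (map B b')" using eq \<open>B l = B m\<close> by simp
  qed (use Cons.prems(4-6) b(1) in auto)
  ultimately show ?case using b by simp
qed simp

text \<open>The first label word determines the letters from the first copy, the second one those from
  the second copy.\<close>

lemma cop2_separation:
  fixes S :: "'a monoid"
  assumes a: "a \<in> fp_carrier {0, 1} (\<lambda>_. S)" and b: "b \<in> fp_carrier {0, 1} (\<lambda>_. S)"
    and F: "\<And>y. y \<in> carrier S \<Longrightarrow> F y \<in> carrier labw \<and> set (F y) \<subseteq> {..2}"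
    and inj: "inj_on F (carrier S)"
    and eq0: "fp_lift labw (\<lambda>i y. if i = 0 then F y else [3]) a =
      fp_lift labw (\<lambda>i y. if i = 0 then F y else [3]) b"
    and eq1: "fp_lift labw (\<lambda>i y. if i = 0 then [0] else relabel Suc (F y)) a =
      fp_lift labw (\<lambda>i y. if i = 0 then [0] else relabel Suc (F y)) b"
  shows "a = b"
proof -
  define B0 where "B0 = (\<lambda>l. if fst l = (0::nat) then F (snd l) else [3])"
  define B1 where "B1 = (\<lambda>l. if fst l = (0::nat) then [0] else map Suc (F (snd l)))"
  have car: "fst l \<in> {0, 1}" "snd l \<in> carrier S" if "l \<in> set a \<union> set b" for l
    using that a b by (auto simp: fp_carrier_iff)
  have F': "F (snd l) \<noteq> []" "distinct_adj (F (snd l))" "set (F (snd l)) \<subseteq> {..2}"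
    if "l \<in> set a \<union> set b" for l
    using F[OF car(2)[OF that]] by auto
  have ne: "w \<noteq> [] \<and> distinct_adj (map fst w) \<and> set w \<subseteq> set a \<union> set b" if "w = a \<or> w = b" for w
    using that a b by (auto simp: fp_carrier_iff)
  have lift0: "fp_lift labw (\<lambda>i y. if i = 0 then F y else [3]) w = concat (map B0 w)"
    if w: "w = a \<or> w = b" for w
  proof -
    have "lprod labw (map B0 w) = remdups_adj (concat (map B0 w))"
    proof (rule lprod_labw)
      show "map B0 w \<noteq> []" using ne[OF w] by simp
      have "B0 l \<in> carrier labw" if "l \<in> set w" for l
        using F'[of l] ne[OF w] that by (auto simp: B0_def)
      then show "set (map B0 w) \<subseteq> carrier labw" by auto
    qed
    also have "\<dots> = concat (map B0 w)"
      unfolding distinct_adj_altdef[symmetric]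
    proof (rule distinct_adj_concat_blocks)
      show "distinct_adj (map fst w)" using ne[OF w] by simp
      show "B0 l \<noteq> [] \<and> distinct_adj (B0 l)" if "l \<in> set w" for l
        using F'[of l] ne[OF w] that by (auto simp: B0_def)
      show "set (B0 l) \<inter> set (B0 l') = {}" if "l \<in> set w" "l' \<in> set w" "fst l \<noteq> fst l'" for l l'
        using F'(3)[of l] F'(3)[of l'] that w car(1)[of l] car(1)[of l'] by (fastforce simp: B0_def)
    qed
    finally show ?thesis by (simp add: fp_lift_def B0_def)
  qed
  have lift1: "fp_lift labw (\<lambda>i y. if i = 0 then [0] else relabel Suc (F y)) w = concat (map B1 w)"
    if w: "w = a \<or> w = b" for w
  proof -
    have "lprod labw (map B1 w) = remdups_adj (concat (map B1 w))"
    proof (rule lprod_labw)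
      show "map B1 w \<noteq> []" using ne[OF w] by simp
      have "B1 l \<in> carrier labw" if "l \<in> set w" for l
        using F'[of l] ne[OF w] that by (auto simp: B1_def distinct_adj_map_iff)
      then show "set (map B1 w) \<subseteq> carrier labw" by auto
    qed
    also have "\<dots> = concat (map B1 w)"
      unfolding distinct_adj_altdef[symmetric]
    proof (rule distinct_adj_concat_blocks)
      show "distinct_adj (map fst w)" using ne[OF w] by simp
      show "B1 l \<noteq> [] \<and> distinct_adj (B1 l)" if "l \<in> set w" for l
        using F'[of l] ne[OF w] that by (auto simp: B1_def distinct_adj_map_iff)
      show "set (B1 l) \<inter> set (B1 l') = {}" if "l \<in> set w" "l' \<in> set w" "fst l \<noteq> fst l'" for l l'
        using that w car(1)[of l] car(1)[of l'] by (fastforce simp: B1_def)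
    qed
    finally have "lprod labw (map B1 w) = concat (map B1 w)" .
    moreover have "map B1 w = map (\<lambda>l. if fst l = 0 then [0] else relabel Suc (F (snd l))) w"
    proof (rule map_cong[OF HOL.refl])
      fix l assume "l \<in> set w"
      then have "l \<in> set a \<union> set b" using ne[OF w] by blast
      from relabel_Suc[OF F'(2)[OF this]] show "B1 l = (if fst l = 0 then [0] else relabel Suc (F (snd l)))"
        by (simp add: B1_def)
    qed
    ultimately show ?thesis unfolding fp_lift_def by metis
  qed
  \<comment> \<open>Merging all labels used by \<open>F\<close> into one recovers the sequence of
    copies, so \<open>a\<close> and \<open>b\<close> have the same pattern.\<close>
  have lift_fst: "relabel (\<lambda>k. if k \<le> 2 then 0 else 1) (fp_lift labw (\<lambda>i y. if i = 0 then F y else [3]) w) =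
      map fst w" if w: "w \<in> fp_carrier {0, 1} (\<lambda>_. S)" for w
  proof -
    have "relabel (\<lambda>k. if k \<le> 2 then 0 else 1) (fp_lift labw (\<lambda>i y. if i = 0 then F y else [3]) w) =
      fp_lift labw (\<lambda>i y. relabel (\<lambda>k. if k \<le> 2 then 0 else 1) (if i = 0 then F y else [3])) w"
      using w by (rule relabel_lift) (use F in auto)
    also have "\<dots> = fp_lift labw (\<lambda>i _. [i]) w"
      using w
    proof (rule fp_lift_cong)
      fix i :: nat and y assume i: "i \<in> {0, 1}" and y: "y \<in> carrier S"
      have "relabel (\<lambda>k. if k \<le> 2 then 0 else 1) (F y) = relabel (\<lambda>_. 0) (F y)"
        by (rule relabel_cong) (use F[OF y] in auto)
      also have "\<dots> = [0]" using F[OF y] by (simp add: relabel_const)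
      finally show "relabel (\<lambda>k. if k \<le> 2 then 0 else 1) (if i = 0 then F y else [3]) = [i]"
        using i by (auto simp: relabel_def)
    qed
    also have "\<dots> = map fst w" using w by (rule lift_labw_fst)
    finally show ?thesis .
  qed
  have fst_eq: "map fst a = map fst b" using lift_fst[OF a] lift_fst[OF b] eq0 by simp
  have da: "distinct_adj (map fst a)" using a by (simp add: fp_carrier_iff)
  have m0: "map B0 a = map B0 b"
    using fst_eq da
  proof (rule concat_blocks_eq[where j = 0 and c = 3])
    show "concat (map B0 a) = concat (map B0 b)" using lift0[of a] lift0[of b] eq0 by simp
    show "B0 l \<noteq> []" if "l \<in> set a \<union> set b" for l using F'[OF that] by (simp add: B0_def)
    show "3 \<notin> set (B0 l)" if "l \<in> set a \<union> set b" "fst l = 0" for l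
      using F'(3)[OF that(1)] that(2) by (auto simp: B0_def)
  qed (simp add: B0_def)
  have m1: "map B1 a = map B1 b"
    using fst_eq da
  proof (rule concat_blocks_eq[where j = 1 and c = 0])
    show "concat (map B1 a) = concat (map B1 b)" using lift1[of a] lift1[of b] eq1 by simp
    show "B1 l \<noteq> []" if "l \<in> set a \<union> set b" for l using F'[OF that] by (simp add: B1_def)
    show "0 \<notin> set (B1 l)" if "l \<in> set a \<union> set b" "fst l = 1" for l
      using that(2) by (auto simp: B1_def)
    show "B1 l = [0]" if "l \<in> set a \<union> set b" "fst l \<noteq> 1" for l
      using that(2) car(1)[OF that(1)] by (auto simp: B1_def)
  qed
  show "a = b"
  proof (rule nth_equalityI)
    show len: "length a = length b" using fst_eq by (rule map_eq_imp_length_eq)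
    fix i assume i: "i < length a"
    then have i': "a ! i \<in> set a \<union> set b" "b ! i \<in> set a \<union> set b" using len by auto
    have f: "fst (a ! i) = fst (b ! i)" "B0 (a ! i) = B0 (b ! i)" "B1 (a ! i) = B1 (b ! i)"
      using fst_eq m0 m1 i len by (metis nth_map)+
    have "F (snd (a ! i)) = F (snd (b ! i))"
      using f by (cases "fst (a ! i) = 0") (auto simp: B0_def B1_def)
    then have "snd (a ! i) = snd (b ! i)"
      using inj car(2)[OF i'(1)] car(2)[OF i'(2)] by (auto dest: inj_onD)
    with f(1) show "a ! i = b ! i" by (simp add: prod_eq_iff)
  qed
qed

section \<open>The cosemigroup R\<close>

abbreviation rg :: "rgen \<Rightarrow> rgen list set" where
  "rg g \<equiv> pcls R_rels [g]"

lemma Rsg_semigroup: "is_semigroup Rsg"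
  unfolding Rsg_def by (rule presented_semigroup)

lemma rg_carrier: "rg g \<in> carrier Rsg"
  unfolding Rsg_def by (simp add: pcls_carrier)

lemma Rsg_mult: "u \<noteq> [] \<Longrightarrow> v \<noteq> [] \<Longrightarrow> pcls R_rels u \<otimes>\<^bsub>Rsg\<^esub> pcls R_rels v = pcls R_rels (u @ v)"
  unfolding Rsg_def by (rule presented_mult)

lemma R_relations:
  "rg X00 \<otimes>\<^bsub>Rsg\<^esub> rg X00 = rg X00" "rg X11 \<otimes>\<^bsub>Rsg\<^esub> rg X11 = rg X11"
  "rg X00 \<otimes>\<^bsub>Rsg\<^esub> rg (P i) = rg (P i)" "rg (P i) \<otimes>\<^bsub>Rsg\<^esub> rg X11 = rg (P i)"
  "rg X11 \<otimes>\<^bsub>Rsg\<^esub> rg (Q i) = rg (Q i)" "rg (Q i) \<otimes>\<^bsub>Rsg\<^esub> rg X00 = rg (Q i)"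
  by (simp_all add: Rsg_mult pcls_eq_iff, (rule pcong.base, simp add: R_rels_def)+)

lemma cop2R_semigroup: "is_semigroup (cop2 Rsg)"
  using Rsg_semigroup by (rule free_prod_semigroup)

lemma gk_carrier: "k \<in> {0, 1} \<Longrightarrow> gk k u \<in> carrier (cop2 Rsg)"
  unfolding gk_def by (rule hom_in_carrier[OF fp_in_hom rg_carrier]) (simp_all add: Rsg_semigroup)

lemma gk_mult:
  "gk k u \<otimes>\<^bsub>cop2 Rsg\<^esub> gk k v = fp_in k (rg u \<otimes>\<^bsub>Rsg\<^esub> rg v)"
  by (simp add: gk_def fp_in_def fp_mult_def)

lemma betaR_gen_carrier: "betaR_gen g \<in> carrier (cop2 Rsg)"
proof -
  note c = gk_carrier[of 0] gk_carrier[of 1] and sg = cop2R_semigroup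
  show ?thesis
    by (cases g; simp only: betaR_gen.simps)
      (intro c semigroup_closed[OF sg] rmul_closed[OF sg] insertI1 insertI2 singletonI)+
qed

lemma rmul_absorb_left:
  assumes "is_semigroup A" "e \<otimes>\<^bsub>A\<^esub> x = x" "e \<in> carrier A" "x \<in> carrier A" "y \<in> carrier A" "z \<in> carrier A"
  shows "e \<otimes>\<^bsub>A\<^esub> (rmul A x y i \<otimes>\<^bsub>A\<^esub> z) = rmul A x y i \<otimes>\<^bsub>A\<^esub> z"
  using assms by (simp add: semigroup_assoc[symmetric] mult_rmul rmul_closed)

lemma rmul_absorb_right:
  assumes "is_semigroup A" "z \<otimes>\<^bsub>A\<^esub> e = z" "e \<in> carrier A" "x \<in> carrier A" "z \<in> carrier A"
  shows "(x \<otimes>\<^bsub>A\<^esub> z) \<otimes>\<^bsub>A\<^esub> e = x \<otimes>\<^bsub>A\<^esub> z"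
  using assms by (simp add: semigroup_assoc)

text \<open>The images of \<open>P i\<close> and \<open>Q i\<close> begin and end with that
  generator in one of the two copies, so the outer idempotents are absorbed there; the inner power
  is not touched.\<close>

lemma betaR_gen_relations:
  assumes "(u, v) \<in> R_rels"
  shows "lprod (cop2 Rsg) (map betaR_gen u) = lprod (cop2 Rsg) (map betaR_gen v)"
proof -
  note sg = cop2R_semigroup
  have c0: "gk 0 u \<in> carrier (cop2 Rsg)" and c1: "gk 1 u \<in> carrier (cop2 Rsg)" for u
    by (rule gk_carrier, simp)+
  note c = c0 c1 semigroup_closed[OF sg] rmul_closed[OF sg]
  note absorb = rmul_absorb_left[OF sg] rmul_absorb_right[OF sg]
  have rel: "gk k X00 \<otimes>\<^bsub>cop2 Rsg\<^esub> gk k X00 = gk k X00" "gk k X11 \<otimes>\<^bsub>cop2 Rsg\<^esub> gk k X11 = gk k X11"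
    "gk k X00 \<otimes>\<^bsub>cop2 Rsg\<^esub> gk k (P i) = gk k (P i)" "gk k (P i) \<otimes>\<^bsub>cop2 Rsg\<^esub> gk k X11 = gk k (P i)"
    "gk k X11 \<otimes>\<^bsub>cop2 Rsg\<^esub> gk k (Q i) = gk k (Q i)" "gk k (Q i) \<otimes>\<^bsub>cop2 Rsg\<^esub> gk k X00 = gk k (Q i)"
    for k i
    unfolding gk_mult R_relations by (simp_all add: gk_def)
  from assms show ?thesis
    unfolding R_rels_def
    by (auto simp: rel absorb c simp del: carrier_free_prod mult_free_prod One_nat_def)
qed

lemma R_rels_not_Nil: "(u, v) \<in> R_rels \<Longrightarrow> u \<noteq> [] \<and> v \<noteq> []"
  by (auto simp: R_rels_def)

text \<open>Shows that the representative picked by \<open>SOME\<close> is immaterial, since the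
  generator images satisfy the relations.\<close>

lemma betaR_pcls:
  assumes "w \<noteq> []"
  shows "betaR (pcls R_rels w) = lprod (cop2 Rsg) (map betaR_gen w)"
proof -
  have "(SOME v. v \<in> pcls R_rels w) \<in> pcls R_rels w"
    using pcls_mem[OF assms] by (rule someI)
  then have "pcong R_rels w (SOME v. v \<in> pcls R_rels w)" by (simp add: pcls_def)
  from pcong_lprod[OF this assms cop2R_semigroup betaR_gen_carrier R_rels_not_Nil betaR_gen_relations]
  show ?thesis by (simp add: betaR_def)
qed

lemma betaR_rg: "betaR (rg g) = betaR_gen g"
  by (simp add: betaR_pcls)

lemma betaR_hom: "betaR \<in> hom Rsg (cop2 Rsg)"
proof (rule homI)
  have car: "set (map betaR_gen w) \<subseteq> carrier (cop2 Rsg)" for w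
    using betaR_gen_carrier by auto
  fix x assume "x \<in> carrier Rsg"
  then obtain u where u: "u \<noteq> []" "x = pcls R_rels u"
    unfolding Rsg_def by (rule presented_carrierE)
  have "lprod (cop2 Rsg) (map betaR_gen u) \<in> carrier (cop2 Rsg)"
    using u car by (intro lprod_closed cop2R_semigroup) auto
  then show "betaR x \<in> carrier (cop2 Rsg)" using u by (simp add: betaR_pcls)
  fix y assume "y \<in> carrier Rsg"
  then obtain v where v: "v \<noteq> []" "y = pcls R_rels v"
    unfolding Rsg_def by (rule presented_carrierE)
  have "lprod (cop2 Rsg) (map betaR_gen u @ map betaR_gen v) =
      lprod (cop2 Rsg) (map betaR_gen u) \<otimes>\<^bsub>cop2 Rsg\<^esub> lprod (cop2 Rsg) (map betaR_gen v)"
    using cop2R_semigroup _ _ car car by (rule lprod_append) (use u v in auto)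
  then show "betaR (x \<otimes>\<^bsub>Rsg\<^esub> y) = betaR x \<otimes>\<^bsub>cop2 Rsg\<^esub> betaR y"
    using u v by (simp add: betaR_pcls Rsg_mult del: mult_free_prod)
qed

text \<open>The multiplication formula of the functor E: the product of \<open>F 0\<close> and
  \<open>F 1\<close> in Hom(R, A), evaluated at the generators.\<close>

lemma lift_betaR_gen:
  assumes A: "is_semigroup A" and F: "\<And>i. i \<in> {0, 1} \<Longrightarrow> F i \<in> hom Rsg A"
  shows "fp_lift A F (betaR (rg X00)) = F 0 (rg X00)"
    "fp_lift A F (betaR (rg X11)) = F 1 (rg X11)"
    "fp_lift A F (betaR (rg (P i))) =
      rmul A (F 0 (rg (P i))) (F 1 (rg X00) \<otimes>\<^bsub>A\<^esub> F 0 (rg X11)) i \<otimes>\<^bsub>A\<^esub> F 1 (rg (P i))"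
    "fp_lift A F (betaR (rg (Q i))) =
      rmul A (F 1 (rg (Q i))) (F 0 (rg X11) \<otimes>\<^bsub>A\<^esub> F 1 (rg X00)) i \<otimes>\<^bsub>A\<^esub> F 0 (rg (Q i))"
proof -
  note sg = cop2R_semigroup
  have H: "fp_lift A F \<in> hom (cop2 Rsg) A" using A F by (rule fp_lift_hom)
  have c0: "gk 0 u \<in> carrier (cop2 Rsg)" and c1: "gk 1 u \<in> carrier (cop2 Rsg)" for u
    by (rule gk_carrier, simp)+
  note c = c0 c1 semigroup_closed[OF sg] rmul_closed[OF sg]
  have gk: "fp_lift A F (gk k u) = F k (rg u)" for k u by (simp add: gk_def)
  show "fp_lift A F (betaR (rg X00)) = F 0 (rg X00)" "fp_lift A F (betaR (rg X11)) = F 1 (rg X11)"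
    by (simp_all add: betaR_rg gk del: One_nat_def)
  show "fp_lift A F (betaR (rg (P i))) =
      rmul A (F 0 (rg (P i))) (F 1 (rg X00) \<otimes>\<^bsub>A\<^esub> F 0 (rg X11)) i \<otimes>\<^bsub>A\<^esub> F 1 (rg (P i))"
    "fp_lift A F (betaR (rg (Q i))) =
      rmul A (F 1 (rg (Q i))) (F 0 (rg X11) \<otimes>\<^bsub>A\<^esub> F 1 (rg X00)) i \<otimes>\<^bsub>A\<^esub> F 0 (rg (Q i))"
    by (simp_all add: betaR_rg gk c hom_mult[OF H] hom_rmul[OF sg H]
        del: carrier_free_prod mult_free_prod One_nat_def)
qed

lemma Rsg_hom_eq:
  assumes "h \<in> hom Rsg A" "k \<in> hom Rsg A" "\<And>g. h (rg g) = k (rg g)" "x \<in> carrier Rsg"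
  shows "h x = k x"
  using assms unfolding Rsg_def by (rule presented_hom_eq)

text \<open>Both sides multiply out to \<open>a c^i b d^j e\<close>. With \<open>i = j\<close> this
  is coassociativity at \<open>P i\<close> and, read backwards, at \<open>Q i\<close>.\<close>

lemma rmul_rmul:
  assumes "is_semigroup A" "a \<in> carrier A" "b \<in> carrier A" "c \<in> carrier A" "d \<in> carrier A" "e \<in> carrier A"
  shows "rmul A (rmul A a c i \<otimes>\<^bsub>A\<^esub> b) d j \<otimes>\<^bsub>A\<^esub> e = rmul A a c i \<otimes>\<^bsub>A\<^esub> (rmul A b d j \<otimes>\<^bsub>A\<^esub> e)"
  using assms by (simp add: semigroup_assoc[symmetric] mult_rmul rmul_closed)

lemma R_cosemigroup: "is_cosemigroup Rsg betaR"
proof -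
  let ?C = "cop3 Rsg"
  let ?L = "\<lambda>y. fp_lift ?C (\<lambda>j z. fp_in j z) (betaR y)"
  let ?R = "\<lambda>y. fp_lift ?C (\<lambda>j z. fp_in (j + 1) z) (betaR y)"
  let ?FL = "\<lambda>i y. if i = 0 then ?L y else fp_in 2 y"
  let ?FR = "\<lambda>i y. if i = 0 then fp_in 0 y else ?R y"
  have sg: "is_semigroup ?C" using Rsg_semigroup by (rule free_prod_semigroup)
  have inh: "fp_in i \<in> hom Rsg ?C" if "i \<in> {0, 1, 2}" for i :: nat
    using that Rsg_semigroup by (rule fp_in_hom)
  have inL: "fp_in i \<in> hom Rsg ?C" if "i \<in> {0, 1}" for i :: nat
    by (rule inh) (use that in auto)
  have inR: "fp_in (i + 1) \<in> hom Rsg ?C" if "i \<in> {0, 1}" for i :: nat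
    by (rule inh) (use that in auto)
  have L: "?L \<in> hom Rsg ?C" using betaR_hom sg inL by (rule lift_comp_hom)
  have R: "?R \<in> hom Rsg ?C" using betaR_hom sg inR by (rule lift_comp_hom)
  have FL: "?FL i \<in> hom Rsg ?C" for i :: nat using L inh[of 2] by (cases "i = 0") simp_all
  have FR: "?FR i \<in> hom Rsg ?C" for i :: nat using R inh[of 0] by (cases "i = 0") simp_all
  have c: "fp_in 0 (rg g) \<in> carrier ?C" "fp_in 1 (rg g) \<in> carrier ?C" "fp_in 2 (rg g) \<in> carrier ?C" for g
    by (rule hom_in_carrier[OF inh rg_carrier], simp)+
  note c = c semigroup_closed[OF sg] rmul_closed[OF sg]
  have eL: "?L (rg X11) = fp_in 1 (rg X11)"
    "?L (rg (P i)) = rmul ?C (fp_in 0 (rg (P i))) (fp_in 1 (rg X00) \<otimes>\<^bsub>?C\<^esub> fp_in 0 (rg X11)) i \<otimes>\<^bsub>?C\<^esub> fp_in 1 (rg (P i))"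
    "?L (rg (Q i)) = rmul ?C (fp_in 1 (rg (Q i))) (fp_in 0 (rg X11) \<otimes>\<^bsub>?C\<^esub> fp_in 1 (rg X00)) i \<otimes>\<^bsub>?C\<^esub> fp_in 0 (rg (Q i))"
    "?L (rg X00) = fp_in 0 (rg X00)" for i
    using lift_betaR_gen[OF sg, of fp_in, OF inL] by simp_all
  have eR: "?R (rg X11) = fp_in 2 (rg X11)" "?R (rg X00) = fp_in 1 (rg X00)"
    "?R (rg (P i)) = rmul ?C (fp_in 1 (rg (P i))) (fp_in 2 (rg X00) \<otimes>\<^bsub>?C\<^esub> fp_in 1 (rg X11)) i \<otimes>\<^bsub>?C\<^esub> fp_in 2 (rg (P i))"
    "?R (rg (Q i)) = rmul ?C (fp_in 2 (rg (Q i))) (fp_in 1 (rg X11) \<otimes>\<^bsub>?C\<^esub> fp_in 2 (rg X00)) i \<otimes>\<^bsub>?C\<^esub> fp_in 1 (rg (Q i))" for i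
    using lift_betaR_gen[OF sg, of "\<lambda>j. fp_in (j + 1)", OF inR] by (simp_all only: add_0 one_add_one)
  have eFL: "fp_lift ?C ?FL (betaR (rg X00)) = ?L (rg X00)" "fp_lift ?C ?FL (betaR (rg X11)) = fp_in 2 (rg X11)"
    "fp_lift ?C ?FL (betaR (rg (P i))) =
      rmul ?C (?L (rg (P i))) (fp_in 2 (rg X00) \<otimes>\<^bsub>?C\<^esub> ?L (rg X11)) i \<otimes>\<^bsub>?C\<^esub> fp_in 2 (rg (P i))"
    "fp_lift ?C ?FL (betaR (rg (Q i))) =
      rmul ?C (fp_in 2 (rg (Q i))) (?L (rg X11) \<otimes>\<^bsub>?C\<^esub> fp_in 2 (rg X00)) i \<otimes>\<^bsub>?C\<^esub> ?L (rg (Q i))" for i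
    using lift_betaR_gen[OF sg FL] by simp_all
  have eFR: "fp_lift ?C ?FR (betaR (rg X00)) = fp_in 0 (rg X00)" "fp_lift ?C ?FR (betaR (rg X11)) = ?R (rg X11)"
    "fp_lift ?C ?FR (betaR (rg (P i))) =
      rmul ?C (fp_in 0 (rg (P i))) (?R (rg X00) \<otimes>\<^bsub>?C\<^esub> fp_in 0 (rg X11)) i \<otimes>\<^bsub>?C\<^esub> ?R (rg (P i))"
    "fp_lift ?C ?FR (betaR (rg (Q i))) =
      rmul ?C (?R (rg (Q i))) (fp_in 0 (rg X11) \<otimes>\<^bsub>?C\<^esub> ?R (rg X00)) i \<otimes>\<^bsub>?C\<^esub> fp_in 0 (rg (Q i))" for i
    using lift_betaR_gen[OF sg FR] by simp_all
  \<comment> \<open>Both bracketings are homomorphisms on R, so comparing them at the generators is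
    enough.\<close>
  have "fp_lift ?C ?FL (betaR (rg g)) = fp_lift ?C ?FR (betaR (rg g))" for g
  proof (cases g)
    case (P i)
    show ?thesis unfolding P eFL eFR eL eR by (rule rmul_rmul[OF sg]) (intro c)+
  next
    case (Q i)
    show ?thesis unfolding Q eFL eFR eL eR by (rule rmul_rmul[OF sg, symmetric]) (intro c)+
  qed (simp_all only: eFL eFR eL eR)
  then have "fp_lift ?C ?FL (betaR x) = fp_lift ?C ?FR (betaR x)" if "x \<in> carrier Rsg" for x
    using that by (rule Rsg_hom_eq[OF lift_comp_hom[OF betaR_hom sg FL] lift_comp_hom[OF betaR_hom sg FR]])
  then show ?thesis
    unfolding is_cosemigroup_def using Rsg_semigroup betaR_hom by blast
qed

section \<open>Label words of the generators of R\<close>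

lemma rmul_labw:
  "w \<in> carrier labw \<Longrightarrow> last w = b \<Longrightarrow> a \<noteq> b \<Longrightarrow> rmul labw w [a, b] i = w @ alt a b i"
  by (induction i arbitrary: w)
    (simp_all add: distinct_adj_altdef[symmetric] distinct_adj_append_iff distinct_adj_altdef[THEN iffD1])

lemma lab1_rg:
  "lab1 betaR (rg X00) = [0]" "lab1 betaR (rg X11) = [1]"
  "lab1 betaR (rg (P i)) = 0 # alt 1 0 i @ [1]" "lab1 betaR (rg (Q i)) = 1 # alt 0 1 i @ [0]"
  using lift_betaR_gen[OF labw_semigroup const_hom_labw, of "\<lambda>i. i"]
    remdups_adj_alt[of 0 1 i "[]"] remdups_adj_alt[of 1 0 i "[]"]
  by (simp_all add: lab1_def rmul_labw)

lemma lab2_rg: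
  "lab2 betaR (rg X00) = [0]" "lab2 betaR (rg X11) = [2]"
  "lab2 betaR (rg (P i)) = climb 2 i @ [2]" "lab2 betaR (rg (Q i)) = map (turn 2 True) (climb 2 i @ [2])"
proof -
  let ?F = "\<lambda>(i::nat) y. if i = 0 then lab1 betaR y else [2]"
  have "?F i \<in> hom Rsg labw" for i
    using lab1_hom[OF R_cosemigroup] const_hom_labw by (cases "i = 0") simp_all
  note e = lift_betaR_gen[OF labw_semigroup, of ?F, OF this]
  have *: "distinct_adj (0 # alt 1 0 i @ [1])" for i
    using remdups_adj_alt[of 0 1 i "[]"] by (simp add: distinct_adj_altdef)
  show "lab2 betaR (rg X00) = [0]" "lab2 betaR (rg X11) = [2]"
    using e(1,2) by (simp_all add: lab2_def lab1_rg)
  show "lab2 betaR (rg (P i)) = climb 2 i @ [2]"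
    using e(3)[of i] * remdups_adj_alt[of 1 2 i "[]"]
    by (simp add: lab2_def lab1_rg rmul_labw climb_simps)
  show "lab2 betaR (rg (Q i)) = map (turn 2 True) (climb 2 i @ [2])"
    using e(4)[of i] remdups_adj_alt[of 2 1 i "1 # alt 0 1 i @ [0]"] remdups_adj_alt[of 1 0 i "[]"]
    by (simp add: lab2_def lab1_rg rmul_labw climb_simps turn_def)
qed

lemma lab3_rg:
  "lab3 betaR (rg X00) = [0]" "lab3 betaR (rg X11) = [3]"
  "lab3 betaR (rg (P i)) = climb 3 i @ [3]" "lab3 betaR (rg (Q i)) = map (turn 3 True) (climb 3 i @ [3])"
proof -
  let ?F = "\<lambda>(i::nat) y. if i = 0 then lab2 betaR y else [3]"
  have "?F i \<in> hom Rsg labw" for i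
    using lab2_hom[OF R_cosemigroup] const_hom_labw by (cases "i = 0") simp_all
  note e = lift_betaR_gen[OF labw_semigroup, of ?F, OF this]
  show "lab3 betaR (rg X00) = [0]" "lab3 betaR (rg X11) = [3]"
    using e(1,2) by (simp_all add: lab3_def lab2_rg)
  have *: "distinct_adj (climb 2 i @ [2])"
    using hom_in_carrier[OF lab2_hom[OF R_cosemigroup] rg_carrier[of "P i"]] by (simp add: lab2_rg)
  show "lab3 betaR (rg (P i)) = climb 3 i @ [3]"
    using e(3)[of i] * remdups_adj_alt[of 2 3 i "[]"]
    by (simp add: lab3_def lab2_rg rmul_labw climb_simps)
  show "lab3 betaR (rg (Q i)) = map (turn 3 True) (climb 3 i @ [3])"
    using e(4)[of i] *
    by (simp add: lab3_def lab2_rg rmul_labw climb_simps turn_def)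
qed

section \<open>Normal forms in R and their label words\<close>

fun idg :: "bool \<Rightarrow> rgen" where
  "idg False = X00"
| "idg True = X11"

fun arr :: "bool \<Rightarrow> nat \<Rightarrow> rgen" where
  "arr False i = P i"
| "arr True i = Q i"

text \<open>A normal form alternates between the two idempotents; \<open>None\<close> passes to the other idempotent
  by mere juxtaposition, \<open>Some i\<close> through \<open>p\<^sub>i\<close> or \<open>q\<^sub>i\<close>.\<close>

fun nf :: "bool \<Rightarrow> nat option list \<Rightarrow> rgen list" where
  "nf s [] = [idg s]"
| "nf s (None # u) = idg s # nf (\<not> s) u"
| "nf s (Some i # u) = arr s i # nf (\<not> s) u"

lemma nf_not_Nil [simp]: "nf s u \<noteq> []"
  by (cases "(s, u)" rule: nf.cases) auto

lemma idg_arr: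
  "rg (idg s) \<otimes>\<^bsub>Rsg\<^esub> rg (idg s) = rg (idg s)"
  "rg (idg s) \<otimes>\<^bsub>Rsg\<^esub> rg (arr s i) = rg (arr s i)"
  "rg (arr s i) \<otimes>\<^bsub>Rsg\<^esub> rg (idg (\<not> s)) = rg (arr s i)"
  by (cases s; simp add: R_relations)+

lemma pcls_Cons: "w \<noteq> [] \<Longrightarrow> pcls R_rels (g # w) = rg g \<otimes>\<^bsub>Rsg\<^esub> pcls R_rels w"
  by (simp add: Rsg_mult)

lemma pcls_Rsg_carrier: "w \<noteq> [] \<Longrightarrow> pcls R_rels w \<in> carrier Rsg"
  unfolding Rsg_def by (rule pcls_carrier)

lemma idg_nf: "rg (idg s) \<otimes>\<^bsub>Rsg\<^esub> pcls R_rels (nf s u) = pcls R_rels (nf s u)"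
proof -
  have absorb: "rg (idg s) \<otimes>\<^bsub>Rsg\<^esub> pcls R_rels (g # w) = pcls R_rels (g # w)"
    if "rg (idg s) \<otimes>\<^bsub>Rsg\<^esub> rg g = rg g" "w \<noteq> []" for g w
    using that
    by (simp add: pcls_Cons semigroup_assoc[OF Rsg_semigroup, symmetric] rg_carrier pcls_Rsg_carrier)
  consider "u = []" | u' where "u = None # u'" | i u' where "u = Some i # u'"
    by (metis list.exhaust option.exhaust)
  then show ?thesis by cases (simp_all add: absorb idg_arr)
qed

text \<open>One generator at a time is multiplied from the left to a normal form: it is absorbed, or
  put in front, or put in front with an idempotent in between.\<close>

lemma pcls_nf: "w \<noteq> [] \<Longrightarrow> \<exists>s u. pcls R_rels w = pcls R_rels (nf s u)"
proof (induction w)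
  case (Cons g w)
  obtain t where t: "g = idg t \<or> (\<exists>i. g = arr t i)"
    by (cases g) (metis idg.simps arr.simps)+
  show ?case
  proof (cases "w = []")
    case True
    have "rg (arr t i) = pcls R_rels (nf t [Some i])" for i
      using idg_arr(3)[of t i] by (simp add: pcls_Cons)
    moreover have "rg (idg t) = pcls R_rels (nf t [])" by simp
    ultimately show ?thesis using t True by blast
  next
    case False
    with Cons.IH obtain s u where w: "pcls R_rels w = pcls R_rels (nf s u)" by blast
    have gw: "pcls R_rels (g # w) = rg g \<otimes>\<^bsub>Rsg\<^esub> pcls R_rels (nf s u)"
      using False w by (simp add: pcls_Cons)
    show ?thesis
    proof (cases "\<exists>i. g = arr t i")
      case True
      then obtain i where g: "g = arr t i" by blast
      show ?thesis
      proof (cases "s = t")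
        case True
        \<comment> \<open>The arrow ends at the idempotent of \<open>\<not> t\<close>, but the
          normal form starts at \<open>t\<close>; making this idempotent visible produces the letter
          \<open>None\<close>.\<close>
        have "rg (arr t i) \<otimes>\<^bsub>Rsg\<^esub> pcls R_rels (nf t u) =
            (rg (arr t i) \<otimes>\<^bsub>Rsg\<^esub> rg (idg (\<not> t))) \<otimes>\<^bsub>Rsg\<^esub> pcls R_rels (nf t u)"
          by (simp add: idg_arr)
        also have "\<dots> = pcls R_rels (nf t (Some i # None # u))"
          by (simp add: pcls_Cons semigroup_assoc[OF Rsg_semigroup] rg_carrier pcls_Rsg_carrier)
        finally show ?thesis using gw g True by blast
      next
        case False
        then have "s = (\<not> t)" by blast
        then have "pcls R_rels (g # w) = pcls R_rels (nf t (Some i # u))"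
          using gw g by (simp add: pcls_Cons)
        then show ?thesis by blast
      qed
    next
      case False
      with t have g: "g = idg t" by blast
      show ?thesis
      proof (cases "s = t")
        case True
        with gw g have "pcls R_rels (g # w) = pcls R_rels (nf t u)" by (simp add: idg_nf)
        then show ?thesis by blast
      next
        case False
        then have "s = (\<not> t)" by blast
        then have "pcls R_rels (g # w) = pcls R_rels (nf t (None # u))"
          using gw g by (simp add: pcls_Cons)
        then show ?thesis by blast
      qed
    qed
  qed
qed simp

text \<open>Kept general in \<open>n\<close> to serve \<open>lab2\<close> and \<open>lab3\<close>
  alike. An arrow ends with the label at which the rest starts, and the two collapse into one; after
  a bare idempotent the labels differ and both stay.\<close>

lemma enc_nf:
  assumes L: "L \<in> hom Rsg labw" and n: "n > 0"
    and gens: "L (rg X00) = [0]" "L (rg X11) = [n]" "\<And>i. L (rg (P i)) = climb n i @ [n]"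
      "\<And>i. L (rg (Q i)) = map (turn n True) (climb n i @ [n])"
  shows "L (pcls R_rels (nf s u)) = enc n s u"
proof (induction u arbitrary: s)
  case Nil
  then show ?case by (cases s) (simp_all add: gens turn_def)
next
  case (Cons c u)
  obtain r where r: "enc n (\<not> s) u = turn n (\<not> s) 0 # r" using enc_eq_Cons n by blast
  have d: "distinct_adj (enc n (\<not> s) u)"
    using hom_in_carrier[OF L pcls_Rsg_carrier[of "nf (\<not> s) u"]] by (simp add: Cons)
  have L_Cons: "L (pcls R_rels (g # nf (\<not> s) u)) = remdups_adj (L (rg g) @ enc n (\<not> s) u)" for g
    using hom_mult[OF L rg_carrier pcls_Rsg_carrier, of "nf (\<not> s) u" g] by (simp add: pcls_Cons Cons)
  show ?case
  proof (cases c)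
    case None
    have "L (rg (idg s)) = [turn n s 0]" by (cases s) (simp_all add: gens turn_def)
    moreover have "turn n s 0 \<noteq> turn n (\<not> s) 0" using n by (simp add: turn_def)
    ultimately show ?thesis
      using None d by (simp add: L_Cons r distinct_adj_altdef[THEN iffD1])
  next
    case (Some i)
    have arr: "L (rg (arr s i)) = map (turn n s) (climb n i) @ [turn n (\<not> s) 0]"
      using map_idI[of "climb n i" "turn n False"] by (cases s) (simp_all add: gens turn_def)
    have "distinct_adj (L (rg (arr s i)))" using hom_in_carrier[OF L rg_carrier] by simp
    then have "remdups_adj (map (turn n s) (climb n i) @ [turn n (\<not> s) 0]) =
        map (turn n s) (climb n i) @ [turn n (\<not> s) 0]"
      by (simp add: arr distinct_adj_altdef)
    from remdups_adj_append_Cons[OF this, of "turn n (\<not> s) 0 # r"] show ?thesis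
      using Some d by (simp add: L_Cons arr r distinct_adj_altdef[THEN iffD1])
  qed
qed

lemma lab2_nf: "lab2 betaR (pcls R_rels (nf s u)) = enc 2 s u"
  and lab3_nf: "lab3 betaR (pcls R_rels (nf s u)) = enc 3 s u"
  using enc_nf[OF lab2_hom[OF R_cosemigroup]] enc_nf[OF lab3_hom[OF R_cosemigroup]] lab2_rg lab3_rg
  by simp_all

text \<open>Every element has a normal form, and \<open>enc2_inj\<close> reads this form off the
  ternary label word.\<close>

lemma lab2_R_inj: "inj_on (lab2 betaR) (carrier Rsg)"
proof (rule inj_onI)
  fix x y assume x: "x \<in> carrier Rsg" and y: "y \<in> carrier Rsg" and eq: "lab2 betaR x = lab2 betaR y"
  have nf: "\<exists>s u. z = pcls R_rels (nf s u)" if "z \<in> carrier Rsg" for z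
  proof -
    obtain w where "w \<noteq> []" "z = pcls R_rels w"
      using \<open>z \<in> carrier Rsg\<close> unfolding Rsg_def by (rule presented_carrierE)
    then show ?thesis using pcls_nf by blast
  qed
  from nf[OF x] nf[OF y] eq show "x = y" by (auto simp: lab2_nf dest: enc2_inj)
qed

section \<open>Finality\<close>

text \<open>Label words are built from the co-operation and constant maps only, so morphisms
  preserve them. With \<open>lab2_R_inj\<close> this gives uniqueness.\<close>

lemma cosg_mor_lab2:
  assumes cs: "is_cosemigroup S \<beta>" "is_cosemigroup S' \<beta>'" and g: "cosg_mor S \<beta> S' \<beta>' g"
    and x: "x \<in> carrier S"
  shows "lab2 \<beta>' (g x) = lab2 \<beta> x"
proof -
  have hom: "g \<in> hom S S'" using g by (simp add: cosg_mor_def)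
  have lift: "fp_lift labw F (\<beta>' (g y)) = fp_lift labw (\<lambda>i z. F i (g z)) (\<beta> y)"
    if F: "\<And>i. F i \<in> hom S' labw" and y: "y \<in> carrier S" for F y
  proof -
    have sg: "is_semigroup (cop2 S')" using cosemigroupD(1)[OF cs(2)] by (rule free_prod_semigroup)
    have "fp_lift labw F \<in> hom (cop2 S') labw" using labw_semigroup F by (rule fp_lift_hom)
    with sg have "fp_lift labw F (fp_lift (cop2 S') (\<lambda>i z. fp_in i (g z)) (\<beta> y)) =
        fp_lift labw (\<lambda>i z. fp_lift labw F (fp_in i (g z))) (\<beta> y)"
      using cosemigroupD(3)[OF cs(1) y]
      by (rule hom_fp_lift)
        (rule hom_in_carrier[OF fp_in_hom[OF _ cosemigroupD(1)[OF cs(2)]] hom_in_carrier[OF hom]])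
    then show ?thesis using g y by (simp add: cosg_mor_def)
  qed
  have lab1: "lab1 \<beta>' (g y) = lab1 \<beta> y" if "y \<in> carrier S" for y
    unfolding lab1_def using lift[OF const_hom_labw that] by simp
  let ?F = "\<lambda>(i::nat) y. if i = 0 then lab1 \<beta>' y else [2]"
  have "?F i \<in> hom S' labw" for i
    using lab1_hom[OF cs(2)] const_hom_labw by (cases "i = 0") simp_all
  from lift[of ?F, OF this x] have "lab2 \<beta>' (g x) = fp_lift labw (\<lambda>i z. ?F i (g z)) (\<beta> x)"
    unfolding lab2_def .
  also have "\<dots> = lab2 \<beta> x"
    unfolding lab2_def using cosemigroupD(3)[OF cs(1) x] by (rule fp_lift_cong) (simp add: lab1)
  finally show ?thesis .
qed

lemma fp_lift_map: "fp_lift A F (map (\<lambda>(i, x). (i, f x)) w) = fp_lift A (\<lambda>i x. F i (f x)) w"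
  unfolding fp_lift_def by (simp add: comp_def case_prod_beta)

lemma exists_cosg_mor_R:
  assumes cs: "is_cosemigroup S \<beta>"
  shows "\<exists>f. cosg_mor S \<beta> Rsg betaR f"
proof -
  note cR = R_cosemigroup
  have "\<exists>r. r \<in> carrier Rsg \<and> lab2 betaR r = lab2 \<beta> x \<and> lab3 betaR r = lab3 \<beta> x"
    if x: "x \<in> carrier S" for x
  proof -
    obtain s u where "lab3 \<beta> x = enc 3 s u" "lab2 \<beta> x = enc 2 s u" using lab3_enc[OF cs x] by blast
    then show ?thesis
      by (intro exI[of _ "pcls R_rels (nf s u)"]) (simp add: lab2_nf lab3_nf pcls_Rsg_carrier)
  qed
  \<comment> \<open>The values are chosen to match both words at once: \<open>lab2\<close> makes
    \<open>f\<close> multiplicative, and \<open>lab3\<close> makes it compatible with the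
    co-operations.\<close>
  then obtain f where f: "\<And>x. x \<in> carrier S \<Longrightarrow> f x \<in> carrier Rsg"
    "\<And>x. x \<in> carrier S \<Longrightarrow> lab2 betaR (f x) = lab2 \<beta> x"
    "\<And>x. x \<in> carrier S \<Longrightarrow> lab3 betaR (f x) = lab3 \<beta> x"
    by metis
  have hom: "f \<in> hom S Rsg"
  proof (rule homI)
    fix x y assume xy: "x \<in> carrier S" "y \<in> carrier S"
    have p: "x \<otimes>\<^bsub>S\<^esub> y \<in> carrier S" using cosemigroupD(1)[OF cs] xy by (rule semigroup_closed)
    have "lab2 betaR (f (x \<otimes>\<^bsub>S\<^esub> y)) = lab2 \<beta> x \<otimes>\<^bsub>labw\<^esub> lab2 \<beta> y"
      using f(2)[OF p] hom_mult[OF lab2_hom[OF cs] xy] by simp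
    also have "\<dots> = lab2 betaR (f x \<otimes>\<^bsub>Rsg\<^esub> f y)"
      using hom_mult[OF lab2_hom[OF cR] f(1)[OF xy(1)] f(1)[OF xy(2)]] f(2) xy by simp
    finally show "f (x \<otimes>\<^bsub>S\<^esub> y) = f x \<otimes>\<^bsub>Rsg\<^esub> f y"
      using inj_onD[OF lab2_R_inj] f(1) p xy semigroup_closed[OF Rsg_semigroup] by blast
  qed (rule f(1))
  have "fp_lift (cop2 Rsg) (\<lambda>i y. fp_in i (f y)) (\<beta> x) = betaR (f x)" if x: "x \<in> carrier S" for x
  proof -
    have bx: "\<beta> x \<in> fp_carrier {0, 1} (\<lambda>_. S)" using cosemigroupD(3)[OF cs x] .
    let ?w = "map (\<lambda>(i, y). (i, f y)) (\<beta> x)"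
    have fst: "map fst ?w = map fst (\<beta> x)" by (simp add: comp_def case_prod_beta)
    have "?w \<in> fp_carrier {0, 1} (\<lambda>_. Rsg)"
      unfolding fp_carrier_iff fst using bx f(1) by (auto simp: fp_carrier_iff)
    \<comment> \<open>Separation with \<open>F\<close> equal to \<open>lab2\<close> on R: both lifts
      of \<open>?w\<close> equal \<open>lab3\<close> of \<open>x\<close>, and both lifts of the
      right-hand side equal \<open>lab3\<close> of \<open>f x\<close>, through
      \<open>lab3_def\<close> and \<open>lab3_alt\<close>.\<close>
    then have "?w = betaR (f x)"
    proof (rule cop2_separation)
      show "betaR (f x) \<in> fp_carrier {0, 1} (\<lambda>_. Rsg)" using cosemigroupD(3)[OF cR f(1)[OF x]] .
      show "lab2 betaR y \<in> carrier labw \<and> set (lab2 betaR y) \<subseteq> {..2}" if "y \<in> carrier Rsg" for y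
        using hom_in_carrier[OF lab2_hom[OF cR] that] set_lab2[OF cR that] by blast
      show "inj_on (lab2 betaR) (carrier Rsg)" by (rule lab2_R_inj)
      have "fp_lift labw (\<lambda>i y. if i = 0 then lab2 betaR y else [3]) ?w = lab3 \<beta> x"
        unfolding fp_lift_map lab3_def using bx by (rule fp_lift_cong) (simp add: f(2))
      then show "fp_lift labw (\<lambda>i y. if i = 0 then lab2 betaR y else [3]) ?w =
          fp_lift labw (\<lambda>i y. if i = 0 then lab2 betaR y else [3]) (betaR (f x))"
        using f(3)[OF x] by (simp add: lab3_def)
      have "fp_lift labw (\<lambda>i y. if i = 0 then [0] else relabel Suc (lab2 betaR y)) ?w = lab3 \<beta> x"
        unfolding fp_lift_map lab3_alt[OF cs x] using bx by (rule fp_lift_cong) (simp add: f(2))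
      then show "fp_lift labw (\<lambda>i y. if i = 0 then [0] else relabel Suc (lab2 betaR y)) ?w =
          fp_lift labw (\<lambda>i y. if i = 0 then [0] else relabel Suc (lab2 betaR y)) (betaR (f x))"
        using f(3)[OF x] lab3_alt[OF cR f(1)[OF x]] by simp
    qed
    moreover have "fp_lift (cop2 Rsg) (\<lambda>i y. fp_in i (f y)) (\<beta> x) = ?w"
      using bx by (intro fp_lift_fp_in) (auto simp: fp_carrier_iff)
    ultimately show ?thesis by simp
  qed
  with hom show ?thesis unfolding cosg_mor_def by blast
qed

theorem theorem11p6:
  shows "is_cosemigroup Rsg betaR \<and>
    (\<forall>(S :: 'a monoid) \<beta>. is_cosemigroup S \<beta> \<longrightarrow>
       (\<exists>f. cosg_mor S \<beta> Rsg betaR f \<and>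
          (\<forall>g. cosg_mor S \<beta> Rsg betaR g \<longrightarrow> (\<forall>x\<in>carrier S. g x = f x))))"
proof (intro conjI allI impI)
  show "is_cosemigroup Rsg betaR" by (rule R_cosemigroup)
  fix S :: "'a monoid" and \<beta> assume cs: "is_cosemigroup S \<beta>"
  obtain f where f: "cosg_mor S \<beta> Rsg betaR f" using exists_cosg_mor_R[OF cs] by blast
  have "g x = f x" if g: "cosg_mor S \<beta> Rsg betaR g" and x: "x \<in> carrier S" for g x
  proof (rule inj_onD[OF lab2_R_inj])
    show "lab2 betaR (g x) = lab2 betaR (f x)"
      using cosg_mor_lab2[OF cs R_cosemigroup g x] cosg_mor_lab2[OF cs R_cosemigroup f x] by simp
    show "g x \<in> carrier Rsg" "f x \<in> carrier Rsg"
      using f g x by (auto simp: cosg_mor_def intro: hom_in_carrier)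
  qed
  with f show "\<exists>f. cosg_mor S \<beta> Rsg betaR f \<and>
      (\<forall>g. cosg_mor S \<beta> Rsg betaR g \<longrightarrow> (\<forall>x\<in>carrier S. g x = f x))"
    by blast
qed

end
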